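(* Let $G$ be a finite group, $V$ a finite-dimensional complex representation of $G$, and $u\in G$ a central element of order $2$ acting by $-1$ on $V$. Then the algebras $A(G,V,u,B)^*$, $B\in S^2V$ (with $G,V,u$ fixed), fall into finitely many isomorphism classes of algebras.
   Context: The ground field is $\mathbb{C}$. $S^2V$ denotes the space of symmetric tensors in $V\otimes V$, and $H^*$ is the dual Hopf algebra. Definition of $A(G,V,u,B)$. Let $\mathbb{C}[G\ltimes V]:=\mathbb{C}[G]\ltimes\Lambda V$ be the Hopf superalgebra generated by $G$ (even) and $V$ (odd), with $gvg^{-1}=g\cdot v$, $vw=-wv$, $\Delta(g)=g\otimes g$, $\Delta(v)=v\otimes1+1\otimes v$, $\varepsilon(g)=1$, $\varepsilon(v)=0$ (tensor products of superalgebras have the super multiplication). Let $J:=e^B\in\Lambda V\otimes\Lambda V\subset\mathbb{C}[G\ltimes V]^{\otimes2}$. The twisted Hopf superalgebra $\mathbb{C}[G\ltimes V]^J$ has the same multiplication and counit, and coproduct $\Delta^J(x)=J^{-1}\Delta(x)J$. For $x$ homogeneous of parity $p(x)$ write $\Delta^J(x)=\Delta^J_0(x)+\Delta^J_1(x)$, where the second tensor factor of $\Delta^J_0(x)$ is even and that of $\Delta_1^J(x)$ is odd. Then $A(G,V,u,B)$ is the ordinary Hopf algebra which, as an algebra with counit, is $\mathbb{C}[G]\ltimes\Lambda V$ (grading forgotten), with coproduct $\widetilde{\Delta^J}(x)=\Delta^J_0(x)-(-1)^{p(x)}(u\otimes1)\Delta^J_1(x)$. *)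

theory Defs
  imports
    Complex_Main
    "HOL-Algebra.Group_Action"
    "HOL-Algebra.Multiplicative_Group"
    "HOL-Algebra.QuotRing"
    "HOL-Algebra.Module"
begin

text \<open>
  Conventions. \<open>V\<close> has an ordered basis \<open>b\<^sub>0, \<dots>, b\<^sub>n\<^sub>-\<^sub>1\<close>, and \<open>D g i j\<close> is the \<open>(i, j)\<close> entry of the
  matrix of \<open>g\<close>, so that \<open>g \<cdot> b\<^sub>j = (\<Sum>i<n. D g i j b\<^sub>i)\<close>. A vector in a space with a given
  finite basis \<open>I\<close> is its coefficient function, which is \<open>0\<close> off \<open>I\<close>; the tensor product of the
  spaces with bases \<open>I\<close> and \<open>K\<close> is the space with basis \<open>I \<times> K\<close>.
\<close>

definition supp_space :: "'i set \<Rightarrow> ('i \<Rightarrow> complex) set" where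
  "supp_space I = {x. \<forall>i. i \<notin> I \<longrightarrow> x i = 0}"

definition bvec :: "'i \<Rightarrow> 'i \<Rightarrow> complex" where
  "bvec i = (\<lambda>k. if k = i then 1 else 0)"

definition tens :: "('i \<Rightarrow> complex) \<Rightarrow> ('k \<Rightarrow> complex) \<Rightarrow> 'i \<times> 'k \<Rightarrow> complex" where
  "tens x y = (\<lambda>(i, k). x i * y k)"

text \<open>
  \<open>\<Lambda>V\<close> has the basis \<open>e\<^sub>S = b\<^bsub>i1\<^esub> \<and> \<dots> \<and> b\<^bsub>ik\<^esub>\<close> for \<open>S = {i1 < \<dots> < ik}\<close> contained in \<open>{..<n}\<close>.
  If \<open>S\<close> and \<open>T\<close> are disjoint then \<open>e\<^sub>S \<and> e\<^sub>T\<close> is \<open>e\<close> indexed by \<open>S \<union> T\<close>, with the sign of the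
  number of pairs \<open>i \<in> S\<close>, \<open>j \<in> T\<close> with \<open>j < i\<close>; otherwise it is \<open>0\<close>.
\<close>

definition wedge :: "(nat set \<Rightarrow> complex) \<Rightarrow> (nat set \<Rightarrow> complex) \<Rightarrow> nat set \<Rightarrow> complex" where
  "wedge x y = (\<lambda>U. \<Sum>S\<in>Pow U.
     (-1) ^ card {(i, j). i \<in> S \<and> j \<in> U - S \<and> j < i} * x S * y (U - S))"

text \<open>The algebra endomorphism of \<open>\<Lambda>V\<close> that extends the linear map of \<open>V\<close> with matrix \<open>M\<close>.\<close>

definition ext_map :: "nat \<Rightarrow> (nat \<Rightarrow> nat \<Rightarrow> complex) \<Rightarrow> (nat set \<Rightarrow> complex) \<Rightarrow> nat set \<Rightarrow> complex" where
  "ext_map n M x = (\<lambda>U. \<Sum>S\<in>Pow {..<n}. x S *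
     foldr (\<lambda>j. wedge (\<lambda>T. \<Sum>i<n. M i j * bvec {i} T)) (sorted_list_of_set S) (bvec {}) U)"

text \<open>The basis element \<open>(g, S)\<close> of \<open>\<complex>[G] \<ltimes> \<Lambda>V\<close> is the product \<open>g e\<^sub>S\<close>, of parity \<open>card S\<close>.\<close>

type_synonym 'g idx = "'g \<times> nat set"

definition idx :: "('g, 'm) monoid_scheme \<Rightarrow> nat \<Rightarrow> 'g idx set" where
  "idx G n = carrier G \<times> Pow {..<n}"

text \<open>
  The product is determined by \<open>(g \<omega>) (h \<eta>) = (g h) ((h\<^sup>-\<^sup>1 \<cdot> \<omega>) \<and> \<eta>)\<close>, which is the relation
  \<open>h\<^sup>-\<^sup>1 v h = h\<^sup>-\<^sup>1 \<cdot> v\<close>.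
\<close>

definition smash :: "('g, 'm) monoid_scheme \<Rightarrow> nat \<Rightarrow> ('g \<Rightarrow> nat \<Rightarrow> nat \<Rightarrow> complex) \<Rightarrow>
    ('g idx \<Rightarrow> complex) ring" where
  "smash G n D = \<lparr>
     carrier = supp_space (idx G n),
     monoid.mult = (\<lambda>x y (k, U). if k \<in> carrier G
       then \<Sum>h\<in>carrier G. wedge (ext_map n (D (inv\<^bsub>G\<^esub> h)) (\<lambda>S. x (k \<otimes>\<^bsub>G\<^esub> inv\<^bsub>G\<^esub> h, S)))
                                 (\<lambda>S. y (h, S)) U
       else 0),
     one = bvec (\<one>\<^bsub>G\<^esub>, {}),
     zero = (\<lambda>_. 0),
     add = (\<lambda>x y p. x p + y p)\<rparr>"

text \<open>The tensor square, with the super multiplication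
  \<open>(a \<otimes> b) (c \<otimes> d) = (-1)\<^bsup>|b||c|\<^esup> a c \<otimes> b d\<close>.\<close>

definition smash2 :: "('g, 'm) monoid_scheme \<Rightarrow> nat \<Rightarrow> ('g \<Rightarrow> nat \<Rightarrow> nat \<Rightarrow> complex) \<Rightarrow>
    ('g idx \<times> 'g idx \<Rightarrow> complex) ring" where
  "smash2 G n D = \<lparr>
     carrier = supp_space (idx G n \<times> idx G n),
     monoid.mult = (\<lambda>X Y p. \<Sum>(a, b)\<in>idx G n \<times> idx G n. \<Sum>(c, d)\<in>idx G n \<times> idx G n.
       (-1) ^ (card (snd b) * card (snd c)) * X (a, b) * Y (c, d) *
       tens (bvec a \<otimes>\<^bsub>smash G n D\<^esub> bvec c) (bvec b \<otimes>\<^bsub>smash G n D\<^esub> bvec d) p),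
     one = tens \<one>\<^bsub>smash G n D\<^esub> \<one>\<^bsub>smash G n D\<^esub>,
     zero = (\<lambda>_. 0),
     add = (\<lambda>X Y p. X p + Y p)\<rparr>"

definition emb_grp :: "'g \<Rightarrow> 'g idx \<Rightarrow> complex" where
  "emb_grp g = bvec (g, {})"

definition emb_vec :: "('g, 'm) monoid_scheme \<Rightarrow> nat \<Rightarrow> 'g idx \<Rightarrow> complex" where
  "emb_vec G i = bvec (\<one>\<^bsub>G\<^esub>, {i})"

definition counit :: "('g, 'm) monoid_scheme \<Rightarrow> ('g idx \<Rightarrow> complex) \<Rightarrow> complex" where
  "counit G x = (\<Sum>g\<in>carrier G. x (g, {}))"

text \<open>
  The multiplicative extension of \<open>\<Delta>(g) = g \<otimes> g\<close> and \<open>\<Delta>(v) = v \<otimes> 1 + 1 \<otimes> v\<close>, computed on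
  the product \<open>g b\<^bsub>i1\<^esub> \<dots> b\<^bsub>ik\<^esub>\<close> and then extended linearly.
\<close>

definition comult :: "('g, 'm) monoid_scheme \<Rightarrow> nat \<Rightarrow> ('g \<Rightarrow> nat \<Rightarrow> nat \<Rightarrow> complex) \<Rightarrow>
    ('g idx \<Rightarrow> complex) \<Rightarrow> 'g idx \<times> 'g idx \<Rightarrow> complex" where
  "comult G n D x = (\<lambda>p. \<Sum>(g, S)\<in>idx G n. x (g, S) *
     (tens (emb_grp g) (emb_grp g) \<otimes>\<^bsub>smash2 G n D\<^esub>
      foldr (\<lambda>i X. (tens (emb_vec G i) \<one>\<^bsub>smash G n D\<^esub> \<oplus>\<^bsub>smash2 G n D\<^esub>
                    tens \<one>\<^bsub>smash G n D\<^esub> (emb_vec G i)) \<otimes>\<^bsub>smash2 G n D\<^esub> X)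
            (sorted_list_of_set S) \<one>\<^bsub>smash2 G n D\<^esub>) p)"

text \<open>\<open>S\<^sup>2V\<close>: the matrix \<open>B\<close> stands for the tensor \<open>\<Sum>i<n. \<Sum>j<n. B i j b\<^sub>i \<otimes> b\<^sub>j\<close>.\<close>

definition sym_tensors :: "nat \<Rightarrow> (nat \<Rightarrow> nat \<Rightarrow> complex) set" where
  "sym_tensors n = {B. (\<forall>i j. B i j = B j i) \<and> (\<forall>i j. \<not> (i < n \<and> j < n) \<longrightarrow> B i j = 0)}"

definition tensor_of :: "('g, 'm) monoid_scheme \<Rightarrow> nat \<Rightarrow> (nat \<Rightarrow> nat \<Rightarrow> complex) \<Rightarrow>
    'g idx \<times> 'g idx \<Rightarrow> complex" where
  "tensor_of G n B = (\<lambda>p. \<Sum>i<n. \<Sum>j<n. B i j * tens (emb_vec G i) (emb_vec G j) p)"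

text \<open>\<open>J = e\<^sup>B\<close> as a coefficientwise series; it is a finite sum because \<open>B\<close> is nilpotent.\<close>

definition twist :: "('g, 'm) monoid_scheme \<Rightarrow> nat \<Rightarrow> ('g \<Rightarrow> nat \<Rightarrow> nat \<Rightarrow> complex) \<Rightarrow>
    (nat \<Rightarrow> nat \<Rightarrow> complex) \<Rightarrow> 'g idx \<times> 'g idx \<Rightarrow> complex" where
  "twist G n D B = (\<lambda>p. \<Sum>k. (tensor_of G n B [^]\<^bsub>smash2 G n D\<^esub> (k::nat)) p / fact k)"

definition comult_J :: "('g, 'm) monoid_scheme \<Rightarrow> nat \<Rightarrow> ('g \<Rightarrow> nat \<Rightarrow> nat \<Rightarrow> complex) \<Rightarrow>
    (nat \<Rightarrow> nat \<Rightarrow> complex) \<Rightarrow> ('g idx \<Rightarrow> complex) \<Rightarrow> 'g idx \<times> 'g idx \<Rightarrow> complex" where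
  "comult_J G n D B x =
     inv\<^bsub>smash2 G n D\<^esub> (twist G n D B) \<otimes>\<^bsub>smash2 G n D\<^esub> comult G n D x
       \<otimes>\<^bsub>smash2 G n D\<^esub> twist G n D B"

text \<open>In both cases \<open>q \<in> {0, 1}\<close> is a parity: \<open>hom_part\<close> is the component of an element of parity \<open>q\<close>,
  and \<open>second_part\<close> is the part of a tensor whose second factor has parity \<open>q\<close>.\<close>

definition hom_part :: "nat \<Rightarrow> ('g idx \<Rightarrow> complex) \<Rightarrow> 'g idx \<Rightarrow> complex" where
  "hom_part q x = (\<lambda>a. if card (snd a) mod 2 = q then x a else 0)"

definition second_part :: "nat \<Rightarrow> ('g idx \<times> 'g idx \<Rightarrow> complex) \<Rightarrow> 'g idx \<times> 'g idx \<Rightarrow> complex" where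
  "second_part q X = (\<lambda>(a, b). if card (snd b) mod 2 = q then X (a, b) else 0)"

text \<open>
  On \<open>x\<close> of parity \<open>q\<close> this is \<open>\<Delta>\<^sup>J\<^sub>0(x) - (-1)\<^sup>q (u \<otimes> 1) \<Delta>\<^sup>J\<^sub>1(x)\<close>, extended linearly. As \<open>u\<close> is even,
  multiplication by \<open>u \<otimes> 1\<close> on the left is the same in the ordinary tensor product as in the
  super one.
\<close>

definition comult_A :: "('g, 'm) monoid_scheme \<Rightarrow> nat \<Rightarrow> ('g \<Rightarrow> nat \<Rightarrow> nat \<Rightarrow> complex) \<Rightarrow> 'g \<Rightarrow>
    (nat \<Rightarrow> nat \<Rightarrow> complex) \<Rightarrow> ('g idx \<Rightarrow> complex) \<Rightarrow> 'g idx \<times> 'g idx \<Rightarrow> complex" where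
  "comult_A G n D u B x = (\<lambda>p. \<Sum>q\<in>{0, 1}.
     second_part 0 (comult_J G n D B (hom_part q x)) p
     - (-1) ^ q * (tens (emb_grp u) \<one>\<^bsub>smash G n D\<^esub> \<otimes>\<^bsub>smash2 G n D\<^esub>
                   second_part 1 (comult_J G n D B (hom_part q x))) p)"

text \<open>\<open>f \<otimes> g\<close> as a linear functional on the tensor square.\<close>

definition tens_functional :: "('g, 'm) monoid_scheme \<Rightarrow> nat \<Rightarrow>
    (('g idx \<Rightarrow> complex) \<Rightarrow> complex) \<Rightarrow> (('g idx \<Rightarrow> complex) \<Rightarrow> complex) \<Rightarrow>
    ('g idx \<times> 'g idx \<Rightarrow> complex) \<Rightarrow> complex" where
  "tens_functional G n f g X =
     (\<Sum>(a, b)\<in>idx G n \<times> idx G n. X (a, b) * (f (bvec a) * g (bvec b)))"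

text \<open>\<open>A(G, V, u, B)\<^sup>*\<close>: all linear functionals on \<open>A\<close>, with product \<open>(f g)(x) = (f \<otimes> g)(\<Delta>(x))\<close>
  for the coproduct \<open>\<Delta>\<close> of \<open>A\<close>, and with the counit of \<open>A\<close> as unit.\<close>

definition dual_A :: "('g, 'm) monoid_scheme \<Rightarrow> nat \<Rightarrow> ('g \<Rightarrow> nat \<Rightarrow> nat \<Rightarrow> complex) \<Rightarrow> 'g \<Rightarrow>
    (nat \<Rightarrow> nat \<Rightarrow> complex) \<Rightarrow> (complex, ('g idx \<Rightarrow> complex) \<Rightarrow> complex) module" where
  "dual_A G n D u B = (let A = supp_space (idx G n) in \<lparr>
     carrier = {f \<in> extensional A.
       (\<forall>x\<in>A. \<forall>y\<in>A. f (\<lambda>a. x a + y a) = f x + f y) \<and>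
       (\<forall>c. \<forall>x\<in>A. f (\<lambda>a. c * x a) = c * f x)},
     monoid.mult = (\<lambda>f g. \<lambda>x\<in>A. tens_functional G n f g (comult_A G n D u B x)),
     one = (\<lambda>x\<in>A. counit G x),
     zero = (\<lambda>x\<in>A. 0),
     add = (\<lambda>f g. \<lambda>x\<in>A. f x + g x),
     smult = (\<lambda>c f. \<lambda>x\<in>A. c * f x)\<rparr>)"

definition alg_iso :: "(complex, 'a) module \<Rightarrow> (complex, 'b) module \<Rightarrow> bool" where
  "alg_iso R S \<longleftrightarrow> (\<exists>h\<in>ring_iso R S.
     \<forall>c. \<forall>x\<in>carrier R. h (c \<odot>\<^bsub>R\<^esub> x) = c \<odot>\<^bsub>S\<^esub> h x)"

definition rep_matrix :: "(complex \<Rightarrow> 'v::ab_group_add \<Rightarrow> 'v) \<Rightarrow> 'v list \<Rightarrow> ('v \<Rightarrow> 'v) \<Rightarrow>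
    nat \<Rightarrow> nat \<Rightarrow> complex" where
  "rep_matrix scale bs f i j = module.representation scale (set bs) (f (bs ! j)) (bs ! i)"

end

theory Submission
  imports Defs
begin

text \<open>
  The super tensor square of \<open>\<Lambda>V\<close> is \<open>\<Lambda>(V \<oplus> V)\<close>, and even elements of it are central. Hence
  \<open>\<Delta>\<^sup>J(g\<omega>) = (g \<otimes> g) e\<^bsup>B - g\<inverse>B\<^esup> \<Delta>(\<omega>)\<close> for \<open>\<omega> \<in> \<Lambda>V\<close>, so the coalgebra \<open>A(G, V, u, B)\<close> is the direct
  sum, over the cosets \<open>{g, ug}\<close>, of subcoalgebras that depend only on the symmetric tensor
  \<open>B - g\<inverse>B = B - (ug)\<inverse>B\<close> (dually, of Clifford algebras extended by the group of order 2).
  If \<open>P\<^sub>g \<in> GL(V)\<close> maps \<open>B - g\<inverse>B\<close> to \<open>B' - g\<inverse>B'\<close> and \<open>P\<^sub>g = P\<^sub>u\<^sub>g\<close>, then \<open>g\<omega> \<mapsto> g \<Lambda>(P\<^sub>g)\<omega>\<close> is an isomorphism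
  of coalgebras. Symmetric tensors over \<open>\<complex>\<close> have finitely many orbits under \<open>GL(V)\<close>.
\<close>

subsection \<open>The exterior algebra of a space with countable basis\<close>

text \<open>The product of the dual reads only the coproduct and the counit of A. So the coalgebra
  isomorphisms need not respect the product of A, and the matrices P_g can be chosen independently
  on different cosets; only g and ug are tied together, because multiplication by u \<otimes> 1
  produces tensors with group labels ug and g. All that matters about B is the function sending g to
  the congruence class of B - g^{-1}B. The inverse appears because group elements are written on the
  left: J^{-1} (g \<otimes> g) = (g \<otimes> g) (g^{-1} J^{-1}). The tie between g and ug is
  harmless because the action of a matrix on S^2 V is quadratic in the matrix and does not see the
  sign of u. The obstacle is the bookkeeping of signs. \<Lambda>V and \<Lambda>(V + V) are placed in
  one exterior algebra on countably many generators, a type of class \<open>ring_1\<close>, with the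
  second copy of V on the generators n, ..., 2n - 1. The super signs of the tensor square then
  become reorderings of generators, and conjugation by group elements, the coproduct of \<Lambda>V
  and parity all become substitutions of generators (\<open>extend\<close>).\<close>

definition inversions :: "nat set \<Rightarrow> nat set \<Rightarrow> nat" where
  "inversions S T = card {(i, j). i \<in> S \<and> j \<in> T \<and> j < i}"

lemma finite_inversions:
  assumes "finite S" "finite T"
  shows "finite {(i, j). i \<in> S \<and> j \<in> T \<and> j < (i::nat)}"
  by (rule finite_subset[of _ "S \<times> T"]) (use assms in auto)

lemma inversions_Un_left:
  assumes "finite S" "finite S'" "finite T" "S \<inter> S' = {}"
  shows "inversions (S \<union> S') T = inversions S T + inversions S' T"
proof -
  have "{(i, j). i \<in> S \<union> S' \<and> j \<in> T \<and> j < i} =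
      {(i, j). i \<in> S \<and> j \<in> T \<and> j < i} \<union> {(i, j). i \<in> S' \<and> j \<in> T \<and> j < i}" by auto
  then show ?thesis unfolding inversions_def
    using assms by (simp add: card_Un_disjoint finite_inversions disjoint_iff)
qed

lemma inversions_Un_right:
  assumes "finite S" "finite T" "finite T'" "T \<inter> T' = {}"
  shows "inversions S (T \<union> T') = inversions S T + inversions S T'"
proof -
  have "{(i, j). i \<in> S \<and> j \<in> T \<union> T' \<and> j < i} =
      {(i, j). i \<in> S \<and> j \<in> T \<and> j < i} \<union> {(i, j). i \<in> S \<and> j \<in> T' \<and> j < i}" by auto
  then show ?thesis unfolding inversions_def
    using assms by (simp add: card_Un_disjoint finite_inversions disjoint_iff)
qed

text \<open>Each pair in \<open>S \<times> T\<close> is an inversion for exactly one of the two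
  orders. This is where the sign of supercommutation comes from.\<close>

lemma inversions_swap:
  assumes "finite S" "finite T" "S \<inter> T = {}"
  shows "inversions S T + inversions T S = card S * card T"
proof -
  have "{(i, j). i \<in> S \<and> j \<in> T \<and> j < i} \<union> prod.swap ` {(i, j). i \<in> T \<and> j \<in> S \<and> j < i} = S \<times> T"
    (is "?A \<union> prod.swap ` ?B = _") using assms(3) by (auto simp: image_iff)
  moreover have "?A \<inter> prod.swap ` ?B = {}" by auto
  moreover have "card (prod.swap ` ?B) = card ?B" by (simp add: card_image)
  moreover have "finite ?A" "finite (prod.swap ` ?B)" using assms(1,2) by (simp_all add: finite_inversions)
  ultimately have "card (S \<times> T) = card ?A + card ?B" using card_Un_disjoint[of ?A "prod.swap ` ?B"] by simp
  then show ?thesis unfolding inversions_def by (simp add: card_cartesian_product)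
qed

lemma wedge_eq: "wedge x y U = (\<Sum>S\<in>Pow U. (-1) ^ inversions S (U - S) * x S * y (U - S))"
  by (simp add: wedge_def inversions_def)

lemma wedge_infinite: "infinite U \<Longrightarrow> wedge x y U = 0"
  by (simp add: wedge_def)

text \<open>Both sides are sums over ordered partitions of \<open>U\<close> into three blocks, and
  both exponents count the inversions between each pair of blocks. The reindexing passes from the
  union of the first two blocks with the first block to the first block with the second.\<close>

lemma wedge_assoc: "wedge (wedge x y) z = wedge x (wedge y z)"
proof
  fix U
  show "wedge (wedge x y) z U = wedge x (wedge y z) U"
  proof (cases "finite U")
    case fin: True
    let ?f = "\<lambda>S A. (-1) ^ (inversions S (A - S) + inversions A (U - A)) * x S * y (A - S) * z (U - A)"
    let ?g = "\<lambda>S T. (-1) ^ (inversions S (U - S) + inversions T (U - S - T)) * x S * y T * z (U - S - T)"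
    have "wedge (wedge x y) z U = (\<Sum>A\<in>Pow U. \<Sum>S\<in>Pow A. ?f S A)"
      unfolding wedge_eq by (simp add: sum_distrib_left sum_distrib_right power_add mult_ac)
    also have "\<dots> = (\<Sum>(A, S)\<in>Sigma (Pow U) Pow. ?f S A)"
      using fin by (subst sum.Sigma) (auto dest: finite_subset)
    also have "\<dots> = (\<Sum>(S, T)\<in>Sigma (Pow U) (\<lambda>S. Pow (U - S)). ?g S T)"
    proof -
      have eq: "?g S (A - S) = ?f S A" if h: "A \<subseteq> U" "S \<subseteq> A" for A S
      proof -
        have f1: "finite A" using h(1) fin by (rule finite_subset)
        have f: "finite A" "finite S" using f1 finite_subset[OF h(2) f1] by simp_all
        have "U - S = (A - S) \<union> (U - A)" "(A - S) \<inter> (U - A) = {}" using h by auto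
        then have 1: "inversions S (U - S) = inversions S (A - S) + inversions S (U - A)"
          using inversions_Un_right[of S "A - S" "U - A"] f fin by simp
        have 2: "inversions A (U - A) = inversions S (U - A) + inversions (A - S) (U - A)"
          using inversions_Un_left[of S "A - S" "U - A"] f fin h by (simp add: Un_absorb1)
        have 3: "U - S - (A - S) = U - A" using h by auto
        show ?thesis unfolding 1 2 3 by (simp only: add_ac)
      qed
      show ?thesis
      proof (rule sum.reindex_bij_witness[of _ "\<lambda>(S, T). (S \<union> T, S)" "\<lambda>(A, S). (S, A - S)"], goal_cases)
        case (5 p)
        then obtain A S where "p = (A, S)" "A \<subseteq> U" "S \<subseteq> A" by auto
        then show ?case using eq[of A S] by (simp only: prod.case)
      qed auto
    qed
    also have "\<dots> = (\<Sum>S\<in>Pow U. \<Sum>T\<in>Pow (U - S). ?g S T)"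
      using fin by (subst sum.Sigma) auto
    also have "\<dots> = wedge x (wedge y z) U"
      unfolding wedge_eq by (simp add: sum_distrib_left sum_distrib_right power_add mult_ac)
    finally show ?thesis .
  qed (simp add: wedge_infinite)
qed

text \<open>For infinite \<open>U\<close> the sum over \<open>Pow U\<close> is 0 by convention, so
  the unit law holds only for functions that vanish on infinite sets. The type \<open>ext\<close>
  consists of such functions.\<close>

lemma wedge_bvec_left: "wedge (bvec {}) x U = (if finite U then x U else 0)"
proof (cases "finite U")
  case True
  have "wedge (bvec {}) x U = (\<Sum>S\<in>Pow U. if S = {} then x U else 0)"
    unfolding wedge_eq by (intro sum.cong) (auto simp: bvec_def inversions_def)
  then show ?thesis using True by (simp add: sum.delta)
qed (simp add: wedge_infinite)

lemma wedge_bvec_right: "wedge x (bvec {}) U = (if finite U then x U else 0)"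
proof (cases "finite U")
  case True
  have "inversions U {} = 0" by (simp add: inversions_def)
  then have "wedge x (bvec {}) U = (\<Sum>S\<in>Pow U. if S = U then x U else 0)"
    unfolding wedge_eq by (intro sum.cong) (auto simp: bvec_def)
  then show ?thesis using True by (simp add: sum.delta)
qed (simp add: wedge_infinite)

text \<open>The support is bounded, but by no bound fixed in the type: \<Lambda>V and \<Lambda>(V +
  V), for every dimension, lie in one ring, and the ring laws hold without carrier
  conditions.\<close>

typedef ext = "{x :: nat set \<Rightarrow> complex. \<exists>N. \<forall>S. x S \<noteq> 0 \<longrightarrow> S \<subseteq> {..<N}}"
  morphisms coeff Ext
  by (rule exI[of _ "\<lambda>_. 0"]) auto

setup_lifting type_definition_ext

lemma coeff_infinite: "infinite S \<Longrightarrow> coeff x S = 0"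
  using coeff[of x] by (auto dest: finite_subset)

lemma ext_eqI: "(\<And>S. finite S \<Longrightarrow> coeff x S = coeff y S) \<Longrightarrow> x = y"
  by (metis coeff_infinite coeff_inject ext)

instantiation ext :: ring_1
begin

lift_definition zero_ext :: ext is "\<lambda>_. 0" by auto

lift_definition one_ext :: ext is "bvec {}" by (auto simp: bvec_def)

lift_definition plus_ext :: "ext \<Rightarrow> ext \<Rightarrow> ext" is "\<lambda>x y S. x S + y S"
proof -
  fix x y :: "nat set \<Rightarrow> complex"
  assume "\<exists>N. \<forall>S. x S \<noteq> 0 \<longrightarrow> S \<subseteq> {..<N}" "\<exists>N. \<forall>S. y S \<noteq> 0 \<longrightarrow> S \<subseteq> {..<N}"
  then obtain N M where "\<forall>S. x S \<noteq> 0 \<longrightarrow> S \<subseteq> {..<N}" "\<forall>S. y S \<noteq> 0 \<longrightarrow> S \<subseteq> {..<M}" by auto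
  then have "\<forall>S. x S + y S \<noteq> 0 \<longrightarrow> S \<subseteq> {..<N} \<or> S \<subseteq> {..<M}" by (metis add.right_neutral)
  then show "\<exists>N. \<forall>S. x S + y S \<noteq> 0 \<longrightarrow> S \<subseteq> {..<N}"
    by (intro exI[of _ "max N M"]) fastforce
qed

lift_definition minus_ext :: "ext \<Rightarrow> ext \<Rightarrow> ext" is "\<lambda>x y S. x S - y S"
proof -
  fix x y :: "nat set \<Rightarrow> complex"
  assume "\<exists>N. \<forall>S. x S \<noteq> 0 \<longrightarrow> S \<subseteq> {..<N}" "\<exists>N. \<forall>S. y S \<noteq> 0 \<longrightarrow> S \<subseteq> {..<N}"
  then obtain N M where "\<forall>S. x S \<noteq> 0 \<longrightarrow> S \<subseteq> {..<N}" "\<forall>S. y S \<noteq> 0 \<longrightarrow> S \<subseteq> {..<M}" by auto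
  then have "\<forall>S. x S - y S \<noteq> 0 \<longrightarrow> S \<subseteq> {..<N} \<or> S \<subseteq> {..<M}" by (metis diff_zero)
  then show "\<exists>N. \<forall>S. x S - y S \<noteq> 0 \<longrightarrow> S \<subseteq> {..<N}"
    by (intro exI[of _ "max N M"]) fastforce
qed

lift_definition uminus_ext :: "ext \<Rightarrow> ext" is "\<lambda>x S. - x S" by auto

lift_definition times_ext :: "ext \<Rightarrow> ext \<Rightarrow> ext" is wedge
proof -
  fix x y :: "nat set \<Rightarrow> complex"
  assume "\<exists>N. \<forall>S. x S \<noteq> 0 \<longrightarrow> S \<subseteq> {..<N}" "\<exists>N. \<forall>S. y S \<noteq> 0 \<longrightarrow> S \<subseteq> {..<N}"
  then obtain N M where NM: "\<forall>S. x S \<noteq> 0 \<longrightarrow> S \<subseteq> {..<N}" "\<forall>S. y S \<noteq> 0 \<longrightarrow> S \<subseteq> {..<M}" by auto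
  have "U \<subseteq> {..<max N M}" if nz: "wedge x y U \<noteq> 0" for U
  proof -
    obtain S where "S \<subseteq> U" "x S \<noteq> 0" "y (U - S) \<noteq> 0"
      using nz unfolding wedge_eq by (rule sum.not_neutral_contains_not_neutral) auto
    then have "S \<subseteq> {..<N}" "U - S \<subseteq> {..<M}" using NM by auto
    then show ?thesis by fastforce
  qed
  then show "\<exists>N. \<forall>S. wedge x y S \<noteq> 0 \<longrightarrow> S \<subseteq> {..<N}" by blast
qed

instance
proof
  fix a b c :: ext
  show "a * b * c = a * (b * c)" by transfer (rule wedge_assoc)
  show "a + b + c = a + (b + c)" by transfer (simp add: add.assoc)
  show "a + b = b + a" by transfer (simp add: add.commute)
  show "0 + a = a" by transfer simp
  show "- a + a = 0" by transfer simp
  show "a - b = a + - b" by transfer simp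
  show "1 * a = a" by (rule ext_eqI) (simp add: times_ext.rep_eq one_ext.rep_eq wedge_bvec_left)
  show "a * 1 = a" by (rule ext_eqI) (simp add: times_ext.rep_eq one_ext.rep_eq wedge_bvec_right)
  show "(a + b) * c = a * c + b * c"
    by transfer (simp add: fun_eq_iff wedge_eq sum.distrib algebra_simps)
  show "a * (b + c) = a * b + a * c"
    by transfer (simp add: fun_eq_iff wedge_eq sum.distrib algebra_simps)
  show "(0::ext) \<noteq> 1" by transfer (auto simp: bvec_def fun_eq_iff)
qed

end

lemma coeff_0 [simp]: "coeff 0 S = 0"
  and coeff_1: "coeff 1 S = bvec {} S"
  and coeff_add [simp]: "coeff (x + y) S = coeff x S + coeff y S"
  and coeff_diff [simp]: "coeff (x - y) S = coeff x S - coeff y S"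
  and coeff_minus [simp]: "coeff (- x) S = - coeff x S"
  and coeff_mult: "coeff (x * y) S = wedge (coeff x) (coeff y) S"
  by (simp_all add: zero_ext.rep_eq one_ext.rep_eq plus_ext.rep_eq minus_ext.rep_eq uminus_ext.rep_eq
      times_ext.rep_eq)

lemma coeff_sum: "coeff (sum f A) S = (\<Sum>a\<in>A. coeff (f a) S)"
  by (induction A rule: infinite_finite_induct) auto

text \<open>Scalars sit in degree 0 as central elements, so scalar multiplication is multiplication
  in the ring.\<close>

lift_definition const :: "complex \<Rightarrow> ext" is "\<lambda>c S. c * bvec {} S"
  by (auto simp: bvec_def)

lift_definition gen :: "nat \<Rightarrow> ext" is "\<lambda>i. bvec {i}"
  subgoal for i by (rule exI[of _ "Suc i"]) (auto simp: bvec_def)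
  done

lemma const_0 [simp]: "const 0 = 0" and const_1 [simp]: "const 1 = 1"
  and const_add: "const (a + b) = const a + const b"
  and const_minus: "const (- a) = - const a"
  by (rule ext_eqI, simp add: const.rep_eq coeff_1 algebra_simps)+

lemma wedge_smult_left: "wedge (\<lambda>S. c * x S) y = (\<lambda>U. c * wedge x y U)"
  and wedge_smult_right: "wedge x (\<lambda>S. c * y S) = (\<lambda>U. c * wedge x y U)"
  unfolding fun_eq_iff wedge_eq sum_distrib_left by (auto intro!: sum.cong)

lemma coeff_const_mult [simp]: "coeff (const c * x) S = c * coeff x S"
  and coeff_mult_const: "coeff (x * const c) S = c * coeff x S"
proof -
  have "coeff (const c) = (\<lambda>S. c * bvec {} S)" by (simp add: const.rep_eq)
  then show "coeff (const c * x) S = c * coeff x S" "coeff (x * const c) S = c * coeff x S"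
    by (cases "finite S"; simp add: coeff_mult wedge_smult_left wedge_smult_right
        wedge_bvec_left wedge_bvec_right coeff_infinite)+
qed

lemma const_commute: "x * const c = const c * x"
  by (rule ext_eqI) (simp add: coeff_mult_const)

lemma const_mult: "const (a * b) = const a * const b"
  by (rule ext_eqI) (simp add: const.rep_eq)

lemma mult_const_left_commute: "x * (const c * y) = const c * (x * y)"
  by (metis const_commute mult.assoc)

lemma const_sum: "const (sum f A) = (\<Sum>a\<in>A. const (f a))"
  by (induction A rule: infinite_finite_induct) (auto simp: const_add)



section \<open>Supports, degrees and supercommutativity\<close>

lemma finite_support: "finite {S. coeff x S \<noteq> 0}"
proof -
  obtain N where "\<forall>S. coeff x S \<noteq> 0 \<longrightarrow> S \<subseteq> {..<N}" using coeff[of x] by auto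
  then have "{S. coeff x S \<noteq> 0} \<subseteq> Pow {..<N}" by auto
  then show ?thesis by (rule finite_subset) auto
qed

lemma nonzero_coeff_mult:
  assumes "coeff (x * y) U \<noteq> 0"
  obtains S T where "coeff x S \<noteq> 0" "coeff y T \<noteq> 0" "U = S \<union> T" "S \<inter> T = {}" "finite S" "finite T"
proof -
  have "finite U" using assms coeff_infinite by blast
  obtain S where S: "S \<subseteq> U" "coeff x S \<noteq> 0" "coeff y (U - S) \<noteq> 0"
    using assms unfolding coeff_mult wedge_eq by (rule sum.not_neutral_contains_not_neutral) auto
  show ?thesis
    by (rule that[of S "U - S"]) (use S \<open>finite U\<close> finite_subset in auto)
qed

text \<open>Exchanging the two blocks of a splitting of \<open>U\<close> changes the sign by the
  parity of \<open>card S * card T\<close>. The hypothesis asks only that this sign be constant over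
  the two supports, which also covers an even element against an arbitrary one.\<close>

lemma supercommute:
  assumes "\<And>S T. coeff x S \<noteq> 0 \<Longrightarrow> coeff y T \<noteq> 0 \<Longrightarrow> (-1) ^ (card S * card T) = s"
  shows "x * y = const s * (y * x)"
proof (rule ext_eqI)
  fix U :: "nat set" assume fin: "finite U"
  have "coeff (x * y) U = (\<Sum>S\<in>Pow U. (-1) ^ inversions S (U - S) * coeff x S * coeff y (U - S))"
    by (simp add: coeff_mult wedge_eq)
  also have "\<dots> = (\<Sum>S\<in>Pow U. s * ((-1) ^ inversions (U - S) S * coeff y (U - S) * coeff x S))"
  proof (rule sum.cong)
    fix S assume "S \<in> Pow U"
    then have S: "S \<subseteq> U" "finite S" using fin by (auto intro: finite_subset)
    show "(-1) ^ inversions S (U - S) * coeff x S * coeff y (U - S) =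
        s * ((-1) ^ inversions (U - S) S * coeff y (U - S) * coeff x S)"
    proof (cases "coeff x S = 0 \<or> coeff y (U - S) = 0")
      case False
      then have "s = (-1) ^ (card S * card (U - S))" using assms[of S "U - S"] by blast
      also have "\<dots> = (-1) ^ inversions S (U - S) * (-1) ^ inversions (U - S) S"
        using inversions_swap[of S "U - S"] S fin by (simp flip: power_add)
      finally have s: "s = (-1) ^ inversions S (U - S) * (-1) ^ inversions (U - S) S" .
      have "s * ((-1) ^ inversions (U - S) S * coeff y (U - S) * coeff x S) =
          (-1) ^ inversions S (U - S) * coeff x S * coeff y (U - S) *
          ((-1) ^ inversions (U - S) S * (-1) ^ inversions (U - S) S)"
        unfolding s by (simp only: mult_ac)
      also have "(-1) ^ inversions (U - S) S * (-1) ^ inversions (U - S) S = (1::complex)"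
        by (simp flip: power_mult_distrib)
      finally show ?thesis by (simp only: mult_1_right)
    qed auto
  qed simp
  also have "\<dots> = s * (\<Sum>S\<in>Pow U. (-1) ^ inversions (U - S) S * coeff y (U - S) * coeff x S)"
    by (simp add: sum_distrib_left)
  also have "(\<Sum>S\<in>Pow U. (-1) ^ inversions (U - S) S * coeff y (U - S) * coeff x S) =
      (\<Sum>S\<in>Pow U. (-1) ^ inversions S (U - S) * coeff y S * coeff x (U - S))"
    by (rule sum.reindex_bij_witness[of _ "\<lambda>S. U - S" "\<lambda>S. U - S"]) (auto simp: double_diff)
  finally have "coeff (x * y) U = s * coeff (y * x) U"
    by (simp only: coeff_mult[of y x] wedge_eq)
  then show "coeff (x * y) U = coeff (const s * (y * x)) U" by (simp only: coeff_const_mult)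
qed

definition homog :: "nat \<Rightarrow> ext \<Rightarrow> bool" where
  "homog k x \<longleftrightarrow> (\<forall>S. card S \<noteq> k \<longrightarrow> coeff x S = 0)"

lemma homog_0 [simp]: "homog k 0"
  and homog_add: "homog k x \<Longrightarrow> homog k y \<Longrightarrow> homog k (x + y)"
  and homog_minus: "homog k x \<Longrightarrow> homog k (- x)"
  and homog_const_mult: "homog k x \<Longrightarrow> homog k (const c * x)"
  by (simp_all add: homog_def)

lemma homog_1: "homog 0 1"
  by (auto simp: homog_def coeff_1 bvec_def)

lemma homog_gen: "homog 1 (gen i)"
  by (auto simp: homog_def gen.rep_eq bvec_def)

lemma homog_sum: "(\<And>a. a \<in> A \<Longrightarrow> homog k (f a)) \<Longrightarrow> homog k (sum f A)"
  by (induction A rule: infinite_finite_induct) (auto intro: homog_add)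

lemma homog_mult:
  assumes "homog k x" "homog l y"
  shows "homog (k + l) (x * y)"
  unfolding homog_def
proof (intro allI impI, rule ccontr)
  fix U assume U: "card U \<noteq> k + l" "coeff (x * y) U \<noteq> 0"
  from U(2) obtain S T where "coeff x S \<noteq> 0" "coeff y T \<noteq> 0" "U = S \<union> T" "S \<inter> T = {}" "finite S" "finite T"
    by (rule nonzero_coeff_mult)
  moreover then have "card S = k" "card T = l" using assms by (auto simp: homog_def)
  ultimately show False using U(1) by (simp add: card_Un_disjoint)
qed

lemma homog_power: "homog k x \<Longrightarrow> homog (k * m) (x ^ m)"
proof (induction m)
  case (Suc m)
  then show ?case using homog_mult[of k x "k * m" "x ^ m"] by (simp add: algebra_simps)
qed (simp add: homog_1)

lemma homog_supercommute:
  assumes "homog k x" "homog l y"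
  shows "x * y = const ((-1) ^ (k * l)) * (y * x)"
proof (rule supercommute)
  fix S T assume "coeff x S \<noteq> 0" "coeff y T \<noteq> 0"
  then have "card S = k" "card T = l" using assms unfolding homog_def by blast+
  then show "(-1) ^ (card S * card T) = ((-1) ^ (k * l) :: complex)" by simp
qed

lemma homog_1_anticommute: "homog 1 x \<Longrightarrow> homog 1 y \<Longrightarrow> x * y = - (y * x)"
  using homog_supercommute[of 1 x 1 y] by (simp add: const_minus)

lemma homog_even_central: "homog k x \<Longrightarrow> even k \<Longrightarrow> x * y = y * x"
proof -
  assume h: "homog k x" "even k"
  have "(-1) ^ (card S * card T) = (1::complex)" if "coeff x S \<noteq> 0" for S T
  proof -
    have "card S = k" using h that unfolding homog_def by blast
    then show ?thesis using h(2) by simp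
  qed
  then have "x * y = const 1 * (y * x)" by (intro supercommute)
  then show ?thesis by simp
qed

subsection \<open>Homomorphisms of exterior algebras\<close>

definition vprod :: "(nat \<Rightarrow> ext) \<Rightarrow> nat set \<Rightarrow> ext" where
  "vprod v S = prod_list (map v (sorted_list_of_set S))"

text \<open>The map of the universal property of the exterior algebra, sending \<open>gen i\<close>
  to \<open>v i\<close>. It is linear for every \<open>v\<close>, and multiplicative once the
  \<open>v i\<close> anticommute.\<close>

definition extend :: "(nat \<Rightarrow> ext) \<Rightarrow> ext \<Rightarrow> ext" where
  "extend v x = (\<Sum>S | coeff x S \<noteq> 0. const (coeff x S) * vprod v S)"

definition anticommuting :: "(nat \<Rightarrow> ext) \<Rightarrow> bool" where
  "anticommuting v \<longleftrightarrow> (\<forall>i j. v i * v j = - (v j * v i))"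

lemma anticommutingI: "(\<And>i. homog 1 (v i)) \<Longrightarrow> anticommuting v"
  unfolding anticommuting_def by (metis homog_1_anticommute)

lemma anticommuting_gen: "anticommuting gen"
  by (rule anticommutingI) (rule homog_gen)

lemma self_anticommute_0: "(x::ext) = - x \<Longrightarrow> x = 0"
proof (rule ext_eqI)
  fix S assume "x = - x"
  from arg_cong[OF this, of "\<lambda>z. coeff z S"] have "coeff x S + coeff x S = 0"
    by (simp add: eq_neg_iff_add_eq_0)
  then show "coeff x S = coeff 0 S" by (simp flip: mult_2)
qed

lemma anticommuting_square: "anticommuting v \<Longrightarrow> v i * v i = 0"
  unfolding anticommuting_def using self_anticommute_0 by blast

lemma extend_superset:
  "finite A \<Longrightarrow> {S. coeff x S \<noteq> 0} \<subseteq> A \<Longrightarrow> extend v x = (\<Sum>S\<in>A. const (coeff x S) * vprod v S)"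
  unfolding extend_def by (rule sum.mono_neutral_left) auto

lemma extend_0 [simp]: "extend v 0 = 0"
  by (simp add: extend_def)

lemma extend_add: "extend v (x + y) = extend v x + extend v y"
proof -
  let ?A = "{S. coeff x S \<noteq> 0} \<union> {S. coeff y S \<noteq> 0}"
  have "finite ?A" using finite_support by auto
  moreover have "{S. coeff (x + y) S \<noteq> 0} \<subseteq> ?A" by auto
  ultimately show ?thesis
    by (simp add: extend_superset[of ?A] const_add distrib_right sum.distrib)
qed

lemma extend_const_mult: "extend v (const c * x) = const c * extend v x"
proof -
  have "{S. coeff (const c * x) S \<noteq> 0} \<subseteq> {S. coeff x S \<noteq> 0}" by auto
  then show ?thesis
    by (simp add: extend_superset[OF finite_support[of x]] const_mult sum_distrib_left mult.assoc)
qed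

lemma extend_minus: "extend v (- x) = - extend v x"
  using extend_const_mult[of v "-1" x] by (simp add: const_minus)

lemma extend_diff: "extend v (x - y) = extend v x - extend v y"
  by (metis diff_conv_add_uminus extend_add extend_minus)

lemma extend_sum: "extend v (sum f A) = (\<Sum>a\<in>A. extend v (f a))"
  by (induction A rule: infinite_finite_induct) (auto simp: extend_add)

lemma vprod_empty [simp]: "vprod v {} = 1"
  by (simp add: vprod_def)

lemma coeff_gen_mult: "coeff (gen i * x) U =
  (if i \<in> U then (-1) ^ card {j \<in> U. j < i} * coeff x (U - {i}) else 0)"
proof (cases "finite U")
  case True
  have "coeff (gen i * x) U = (\<Sum>S\<in>Pow U. if S = {i} then (-1) ^ inversions {i} (U - {i}) * coeff x (U - {i}) else 0)"
    unfolding coeff_mult wedge_eq by (intro sum.cong) (auto simp: gen.rep_eq bvec_def)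
  also have "\<dots> = (if i \<in> U then (-1) ^ inversions {i} (U - {i}) * coeff x (U - {i}) else 0)"
    using True by (simp add: sum.delta)
  also have "inversions {i} (U - {i}) = card {j \<in> U. j < i}"
  proof -
    have "{(a, j). a \<in> {i} \<and> j \<in> U - {i} \<and> j < a} = Pair i ` {j \<in> U. j < i}" by auto
    moreover have "inj_on (Pair i) {j \<in> U. j < i}" by (auto intro: inj_onI)
    ultimately show ?thesis unfolding inversions_def by (simp only: card_image)
  qed
  finally show ?thesis .
qed (simp add: coeff_infinite)

text \<open>The minimum stands first in the ordered product, so multiplying by it from the left
  creates no inversion and the sign stays +1.\<close>

lemma coeff_vprod_gen: "finite S \<Longrightarrow> coeff (vprod gen S) = bvec S"
proof (induction "card S" arbitrary: S)
  case 0
  then show ?case by (auto simp: coeff_1)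
next
  case (Suc k)
  then have ne: "S \<noteq> {}" by auto
  let ?m = "Min S"
  have m: "?m \<in> S" "\<And>j. j \<in> S \<Longrightarrow> ?m \<le> j" using Suc ne by auto
  have IH: "coeff (vprod gen (S - {?m})) = bvec (S - {?m})"
    using Suc m by (intro Suc(1)) auto
  have eq: "vprod gen S = gen ?m * vprod gen (S - {?m})"
    using sorted_list_of_set_nonempty[OF Suc(3) ne] by (simp add: vprod_def)
  show ?case
  proof
    fix U
    show "coeff (vprod gen S) U = bvec S U"
    proof (cases "?m \<in> U \<and> U - {?m} = S - {?m}")
      case True
      then have "U = S" using m(1) by auto
      moreover have "card {j \<in> S. j < ?m} = 0" using m(2) by (metis (no_types, lifting) card.empty empty_Collect_eq leD)
      ultimately show ?thesis unfolding eq coeff_gen_mult IH using m(1) by (simp only: if_True) (simp add: bvec_def)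
    next
      case False
      then show ?thesis unfolding eq coeff_gen_mult IH using m(1) by (auto simp: bvec_def)
    qed
  qed
qed

lemma extend_gen_id: "extend gen x = x"
proof (rule ext_eqI)
  fix U :: "nat set" assume fin: "finite U"
  let ?A = "insert U {S. coeff x S \<noteq> 0}"
  have finite: "finite S" if "coeff x S \<noteq> 0" for S using that coeff_infinite by blast
  have "coeff (extend gen x) U = (\<Sum>S\<in>?A. coeff x S * coeff (vprod gen S) U)"
    using finite_support[of x] by (subst extend_superset[of ?A]) (auto simp: coeff_sum)
  also have "\<dots> = (\<Sum>S\<in>?A. if S = U then coeff x U else 0)"
  proof (intro sum.cong refl)
    fix S assume "S \<in> ?A"
    then have "finite S" using fin finite by auto
    then show "coeff x S * coeff (vprod gen S) U = (if S = U then coeff x U else 0)"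
      by (simp add: coeff_vprod_gen bvec_def)
  qed
  also have "\<dots> = coeff x U" using finite_support[of x] by simp
  finally show "coeff (extend gen x) U = coeff x U" .
qed

lemma extend_vprod_gen: "finite S \<Longrightarrow> extend v (vprod gen S) = vprod v S"
proof -
  assume "finite S"
  then have "{T. coeff (vprod gen S) T \<noteq> 0} = {S}" by (auto simp: coeff_vprod_gen bvec_def)
  then show ?thesis using \<open>finite S\<close> by (simp add: extend_def coeff_vprod_gen bvec_def)
qed

lemma extend_1 [simp]: "extend v 1 = 1"
  using extend_vprod_gen[of "{}" v] by simp

lemma extend_const: "extend v (const c) = const c"
  using extend_const_mult[of v c 1] by simp

lemma extend_gen [simp]: "extend v (gen i) = v i"
  using extend_vprod_gen[of "{i}" v] by (simp add: vprod_def)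

text \<open>Sorting \<open>v i\<close> into the product costs one sign for each smaller index and
  gives 0 if the index repeats. The sign does not depend on \<open>v\<close>; comparing this rule
  for \<open>gen\<close> and for \<open>v\<close> is what makes \<open>extend v\<close>
  multiplicative.\<close>

lemma vprod_insert:
  assumes "anticommuting v" "finite S"
  shows "v i * vprod v S = (if i \<in> S then 0 else (-1) ^ card {j \<in> S. j < i} * vprod v (insert i S))"
proof -
  have list: "v i * prod_list (map v xs) =
      (if i \<in> set xs then 0 else (-1) ^ length (filter (\<lambda>j. j < i) xs) * prod_list (map v (insort i xs)))"
    if "sorted_wrt (<) xs" for xs
    using that
  proof (induction xs)
    case (Cons a xs)
    consider "i < a" | "i = a" | "a < i" by linarith
    then show ?case
    proof cases
      case 1
      then have "filter (\<lambda>j. j < i) (a # xs) = []" using Cons.prems by (auto simp: filter_empty_conv)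
      then show ?thesis using 1 Cons.prems by auto
    next
      case 2
      then show ?thesis using anticommuting_square[OF assms(1)] by (simp flip: mult.assoc)
    next
      case 3
      have "v i * v a = - (v a * v i)" using assms(1) unfolding anticommuting_def by blast
      then have 1: "v i * prod_list (map v (a # xs)) = - (v a * (v i * prod_list (map v xs)))"
        by (simp add: mult.assoc[symmetric] del: mult.assoc)
      have 2: "v a * ((-1) ^ k * y) = (-1) ^ k * (v a * y)" for k :: nat and y
        by (induction k) auto
      have IH: "v i * prod_list (map v xs) = (if i \<in> set xs then 0
          else (-1) ^ length (filter (\<lambda>j. j < i) xs) * prod_list (map v (insort i xs)))"
        using Cons by simp
      show ?thesis unfolding 1 IH using 3 by (simp add: 2)
    qed
  qed simp
  have "set (filter (\<lambda>j. j < i) (sorted_list_of_set S)) = {j \<in> S. j < i}" using assms(2) by auto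
  then have "length (filter (\<lambda>j. j < i) (sorted_list_of_set S)) = card {j \<in> S. j < i}"
    by (metis distinct_card distinct_filter distinct_sorted_list_of_set)
  then show ?thesis unfolding vprod_def
    using list[OF strict_sorted_list_of_set[of S]] assms(2) by (simp add: sorted_list_of_set_insert_remove)
qed

lemma ext_expand: "x = (\<Sum>S | coeff x S \<noteq> 0. const (coeff x S) * vprod gen S)"
  using extend_gen_id[of x] by (simp add: extend_def)

lemma ext_induct [case_names const add gen_mult]:
  assumes "\<And>c. P (const c)" "\<And>x y. P x \<Longrightarrow> P y \<Longrightarrow> P (x + y)" "\<And>i x. P x \<Longrightarrow> P (gen i * x)"
  shows "P x"
proof -
  have P0: "P 0" using assms(1)[of 0] by simp
  \<comment> \<open>The scalar stands on the right so that the empty product is the base case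
    \<open>const c\<close>.\<close>
  have "P (prod_list (map gen xs) * const c)" for xs c
    by (induction xs) (auto intro: assms simp: mult.assoc)
  then have "P (const c * vprod gen S)" for c S unfolding vprod_def by (metis const_commute)
  then have "P (\<Sum>S\<in>A. const (coeff x S) * vprod gen S)" for A
    by (induction A rule: infinite_finite_induct) (auto intro: P0 assms)
  then show ?thesis by (metis ext_expand)
qed

lemma extend_sign: "extend v ((-1) ^ k * x) = (-1) ^ k * extend v x"
  by (induction k) (auto simp: extend_minus)

lemma extend_gen_mult:
  assumes "anticommuting v"
  shows "extend v (gen i * y) = v i * extend v y"
proof -
  have mono: "extend v (gen i * vprod gen S) = v i * vprod v S" if "finite S" for S
    using that by (simp add: vprod_insert[OF anticommuting_gen] vprod_insert[OF assms] extend_sign extend_vprod_gen)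
  have fin: "finite S" if "coeff y S \<noteq> 0" for S using that coeff_infinite by blast
  have "gen i * y = (\<Sum>S | coeff y S \<noteq> 0. const (coeff y S) * (gen i * vprod gen S))"
    by (subst ext_expand[of y]) (simp add: sum_distrib_left mult_const_left_commute)
  then have "extend v (gen i * y) = (\<Sum>S | coeff y S \<noteq> 0. const (coeff y S) * (v i * vprod v S))"
    using fin by (simp add: extend_sum extend_const_mult mono)
  then show ?thesis by (simp add: extend_def sum_distrib_left mult_const_left_commute)
qed

lemma extend_mult: "anticommuting v \<Longrightarrow> extend v (x * y) = extend v x * extend v y"
  by (induction x rule: ext_induct)
    (auto simp: extend_const extend_const_mult extend_add distrib_right extend_gen_mult mult.assoc)

lemma extend_power: "anticommuting v \<Longrightarrow> extend v (x ^ k) = extend v x ^ k"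
  by (induction k) (auto simp: extend_mult)

lemma extend_vprod: "anticommuting w \<Longrightarrow> extend w (vprod v S) = vprod (\<lambda>i. extend w (v i)) S"
proof -
  assume w: "anticommuting w"
  have "extend w (prod_list (map v xs)) = prod_list (map (\<lambda>i. extend w (v i)) xs)" for xs
    by (induction xs) (auto simp: extend_mult[OF w])
  then show ?thesis by (simp add: vprod_def)
qed

text \<open>Only the outer map has to be multiplicative, since the inner one is by definition a
  combination of ordered products.\<close>

lemma extend_extend: "anticommuting w \<Longrightarrow> extend w (extend v x) = extend (\<lambda>i. extend w (v i)) x"
  unfolding extend_def[of v] extend_def[of "\<lambda>i. extend w (v i)"]
  by (simp add: extend_sum extend_const_mult extend_vprod)

lemma vprod_cong: "(\<And>i. i \<in> S \<Longrightarrow> v i = w i) \<Longrightarrow> vprod v S = vprod w S"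
  unfolding vprod_def
  by (metis (mono_tags, lifting) empty_iff empty_set map_eq_conv set_sorted_list_of_set
      sorted_list_of_set.fold_insort_key.infinite)

lemma extend_cong:
  "(\<And>S i. coeff x S \<noteq> 0 \<Longrightarrow> i \<in> S \<Longrightarrow> v i = w i) \<Longrightarrow> extend v x = extend w x"
  unfolding extend_def by (intro sum.cong refl) (metis (mono_tags, lifting) mem_Collect_eq vprod_cong)

lemma homog_vprod:
  assumes "\<And>i. homog 1 (v i)" "finite S"
  shows "homog (card S) (vprod v S)"
proof -
  have "homog (length xs) (prod_list (map v xs))" for xs
  proof (induction xs)
    case (Cons a xs)
    then show ?case using homog_mult[OF assms(1)[of a]] by simp
  qed (simp add: homog_1)
  then show ?thesis unfolding vprod_def by (metis length_sorted_list_of_set)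
qed

lemma homog_extend:
  assumes "\<And>i. homog 1 (v i)" "homog k x"
  shows "homog k (extend v x)"
  unfolding extend_def
proof (intro homog_sum homog_const_mult)
  fix S assume "S \<in> {S. coeff x S \<noteq> 0}"
  then show "homog k (vprod v S)" using homog_vprod[of v S] assms coeff_infinite[of S x]
    unfolding homog_def by fastforce
qed

subsection \<open>Elements supported on initial generators\<close>

definition below :: "nat \<Rightarrow> ext \<Rightarrow> bool" where
  "below N x \<longleftrightarrow> (\<forall>S. \<not> S \<subseteq> {..<N} \<longrightarrow> coeff x S = 0)"

lemma below_0 [simp]: "below N 0" and below_1 [simp]: "below N 1"
  and below_add: "below N x \<Longrightarrow> below N y \<Longrightarrow> below N (x + y)"
  and below_const_mult: "below N x \<Longrightarrow> below N (const c * x)"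
  and below_gen: "i < N \<Longrightarrow> below N (gen i)"
  by (auto simp: below_def coeff_1 bvec_def gen.rep_eq)

lemma below_mono: "below N x \<Longrightarrow> N \<le> M \<Longrightarrow> below M x"
  unfolding below_def by (meson lessThan_subset_iff order_trans)

lemma below_sum: "(\<And>a. a \<in> A \<Longrightarrow> below N (f a)) \<Longrightarrow> below N (sum f A)"
  by (induction A rule: infinite_finite_induct) (auto intro: below_add)

lemma below_mult: "below N x \<Longrightarrow> below N y \<Longrightarrow> below N (x * y)"
  unfolding below_def by (metis (no_types, lifting) Un_least nonzero_coeff_mult)

lemma below_power: "below N x \<Longrightarrow> below N (x ^ k)"
  by (induction k) (auto intro: below_mult)

lemma below_vprod:
  assumes "\<And>i. i \<in> S \<Longrightarrow> below N (v i)"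
  shows "below N (vprod v S)"
proof -
  have "(\<forall>i\<in>set xs. below N (v i)) \<Longrightarrow> below N (prod_list (map v xs))" for xs
    by (induction xs) (auto intro: below_mult)
  moreover have "set (sorted_list_of_set S) \<subseteq> S"
    by (metis empty_subsetI empty_set order_refl set_sorted_list_of_set sorted_list_of_set.fold_insort_key.infinite)
  ultimately show ?thesis unfolding vprod_def using assms by blast
qed

lemma below_extend: "(\<And>i. below N (v i)) \<Longrightarrow> below N (extend v x)"
  unfolding extend_def by (intro below_sum below_const_mult below_vprod)

lemma below_expand:
  assumes "below N x"
  shows "extend v x = (\<Sum>S\<in>Pow {..<N}. const (coeff x S) * vprod v S)"
  using assms by (intro extend_superset) (auto simp: below_def)

text \<open>More than \<open>N\<close> distinct indices do not fit below \<open>N\<close>. This is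
  the source of all nilpotency: high powers of B and tails of exponentials vanish by degree.\<close>

lemma homog_below_0:
  assumes "homog k x" "below N x" "k > N"
  shows "x = 0"
proof (rule ext_eqI)
  fix S
  show "coeff x S = coeff 0 S"
  proof (rule ccontr)
    assume "coeff x S \<noteq> coeff 0 S"
    then have "card S = k" "S \<subseteq> {..<N}" using assms unfolding homog_def below_def by auto
    then have "k \<le> N" using card_mono[of "{..<N}" S] by simp
    then show False using assms(3) by simp
  qed
qed

subsection \<open>Truncated exponentials\<close>

text \<open>For an element of degree 2 in \<open>2 * m\<close> generators all powers beyond the
  \<open>m\<close>-th vanish, so this is its full exponential.\<close>

definition texp :: "nat \<Rightarrow> ext \<Rightarrow> ext" where
  "texp m x = (\<Sum>k\<le>m. const (1 / fact k) * x ^ k)"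

lemma texp_0 [simp]: "texp m 0 = 1"
proof -
  have "texp m 0 = (\<Sum>k\<le>m. if k = 0 then 1 else 0)"
    unfolding texp_def by (intro sum.cong) (auto simp: power_0_left)
  then show ?thesis by simp
qed

lemma extend_texp: "anticommuting v \<Longrightarrow> extend v (texp m x) = texp m (extend v x)"
  by (simp add: texp_def extend_sum extend_const_mult extend_power)

text \<open>The binomial theorem in divided powers, for a commuting pair in the noncommutative ring
  \<open>ext\<close>. The induction step is proved after multiplication by the invertible scalar
  \<open>Suc k\<close>.\<close>

lemma divided_power_add:
  assumes "x * y = y * (x::ext)"
  shows "const (1 / fact k) * (x + y) ^ k =
    (\<Sum>i\<le>k. const (1 / fact i) * x ^ i * (const (1 / fact (k - i)) * y ^ (k - i)))"
proof -
  let ?d = "\<lambda>x i. const (1 / fact i) * (x::ext) ^ i"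
  have step: "const (of_nat (Suc i)) * ?d z (Suc i) = z * ?d z i" for z i
  proof -
    have "of_nat (Suc i) * (1 / fact (Suc i)) = (1 / fact i :: complex)"
      by (simp add: fact_Suc del: of_nat_Suc)
    then have "const (of_nat (Suc i)) * ?d z (Suc i) = const (1 / fact i) * (z * z ^ i)"
      by (simp only: mult.assoc[symmetric] const_mult[symmetric] power_Suc)
    then show ?thesis by (simp only: mult_const_left_commute[of z])
  qed
  show ?thesis
  proof (induction k)
    case (Suc k)
    have cm: "y * ?d x i = ?d x i * y" for i
      using power_commuting_commutes[OF assms, of i] by (simp add: mult_const_left_commute[of y] mult.assoc)
    let ?S = "\<lambda>k. \<Sum>i\<le>k. ?d x i * ?d y (k - i)"
    \<comment> \<open>The weight \<open>Suc k\<close> is split as \<open>i + (Suc k - i)\<close>;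
      the first part lowers the divided power of \<open>x\<close> by one, the second that of
      \<open>y\<close>.\<close>
    have "const (of_nat (Suc k)) * ?S (Suc k) =
        (\<Sum>i\<le>Suc k. const (of_nat i) * (?d x i * ?d y (Suc k - i))) +
        (\<Sum>i\<le>Suc k. const (of_nat (Suc k - i)) * (?d x i * ?d y (Suc k - i)))"
      unfolding sum_distrib_left sum.distrib[symmetric]
      by (intro sum.cong refl) (simp add: distrib_right[symmetric] const_add[symmetric] of_nat_add[symmetric] del: of_nat_add of_nat_Suc)
    also have "(\<Sum>i\<le>Suc k. const (of_nat i) * (?d x i * ?d y (Suc k - i))) = x * ?S k"
    proof -
      have "const (of_nat (Suc i)) * (?d x (Suc i) * ?d y (k - i)) = x * (?d x i * ?d y (k - i))" for i
        unfolding mult.assoc[of _ "?d x (Suc i)", symmetric] step by (simp only: mult.assoc)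
      then show ?thesis
        unfolding sum.atMost_Suc_shift sum_distrib_left
        by (simp only: diff_Suc_Suc of_nat_0 const_0 mult_zero_left add_0)
    qed
    also have "(\<Sum>i\<le>Suc k. const (of_nat (Suc k - i)) * (?d x i * ?d y (Suc k - i))) = y * ?S k"
    proof -
      have "const (of_nat (Suc k - i)) * (?d x i * ?d y (Suc k - i)) = y * (?d x i * ?d y (k - i))"
        if "i \<le> k" for i
      proof -
        have "const (of_nat (Suc k - i)) * (?d x i * ?d y (Suc k - i)) =
            ?d x i * (const (of_nat (Suc (k - i))) * ?d y (Suc (k - i)))"
          by (simp only: Suc_diff_le[OF that] mult_const_left_commute[of "?d x i"])
        also have "\<dots> = ?d x i * (y * ?d y (k - i))" by (simp only: step)
        also have "\<dots> = y * (?d x i * ?d y (k - i))"          unfolding mult.assoc[of "?d x i" y, symmetric] cm[of i, symmetric] by (simp only: mult.assoc)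
        finally show ?thesis .
      qed
      then show ?thesis by (simp add: sum_distrib_left)
    qed
    also have "x * ?S k + y * ?S k = (x + y) * ?d (x + y) k"
      by (simp only: Suc distrib_right)
    also have "\<dots> = const (of_nat (Suc k)) * ?d (x + y) (Suc k)"
      by (simp only: step)
    finally have eq: "const (of_nat (Suc k)) * ?d (x + y) (Suc k) = const (of_nat (Suc k)) * ?S (Suc k)" by simp
    have inv: "const (1 / of_nat (Suc k)) * (const (of_nat (Suc k)) * z) = z" for z
      by (simp add: mult.assoc[symmetric] const_mult[symmetric] del: of_nat_Suc)
    from arg_cong[OF eq, of "\<lambda>w. const (1 / of_nat (Suc k)) * w"] show ?case by (simp only: inv)
  qed simp
qed

text \<open>The left side expands to a sum over the triangle \<open>i + j \<le> m\<close>, the right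
  side to one over the square; the extra terms of the square have degree above \<open>2 * m\<close>
  and vanish.\<close>

lemma texp_add:
  assumes "homog 2 x" "homog 2 y" "below (2 * m) x" "below (2 * m) y"
  shows "texp m (x + y) = texp m x * texp m y"
proof -
  let ?d = "\<lambda>x i. const (1 / fact i) * (x::ext) ^ i"
  let ?f = "\<lambda>(i, j). ?d x i * ?d y j"
  have zero: "?f p = 0" if "fst p + snd p > m" for p
  proof -
    have "homog (2 * fst p + 2 * snd p) (?f p)"
      using assms by (auto simp: case_prod_beta intro!: homog_mult homog_const_mult homog_power)
    moreover have "below (2 * m) (?f p)"
      using assms by (auto simp: case_prod_beta intro!: below_mult below_const_mult below_power)
    ultimately show ?thesis using that homog_below_0 by fastforce
  qed
  have "texp m (x + y) = (\<Sum>k\<le>m. \<Sum>i\<le>k. ?f (i, k - i))"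
    unfolding texp_def using divided_power_add[OF homog_even_central[OF assms(1)]] by simp
  also have "\<dots> = sum ?f {(i, j). i + j \<le> m}"
    using sum.triangle_reindex_eq[of "\<lambda>i j. ?f (i, j)" m] by simp
  also have "\<dots> = sum ?f ({..m} \<times> {..m})"
  proof (rule sum.mono_neutral_left)
    show "\<forall>p\<in>{..m} \<times> {..m} - {(i, j). i + j \<le> m}. ?f p = 0"
      using zero by (intro ballI) (simp add: case_prod_beta)
  qed auto
  also have "\<dots> = texp m x * texp m y"
    unfolding texp_def sum_product sum.cartesian_product by simp
  finally show ?thesis .
qed

lemma homog_even_texp_central: "homog 2 x \<Longrightarrow> texp m x * y = y * texp m x"
  unfolding texp_def sum_distrib_left sum_distrib_right
  by (intro sum.cong refl) (metis dvd_triv_left homog_const_mult homog_even_central homog_power)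

subsection \<open>Components of the smash product\<close>

text \<open>The bridge from raw coefficient functions, which may be nonzero anywhere, to ring
  elements in \<Lambda>V.\<close>

definition trunc :: "nat \<Rightarrow> (nat set \<Rightarrow> complex) \<Rightarrow> ext" where
  "trunc n x = (\<Sum>S\<in>Pow {..<n}. const (x S) * vprod gen S)"

lemma finite_subset_lessThan: "S \<subseteq> {..<n::nat} \<Longrightarrow> finite S"
  by (rule finite_subset) auto

lemma below_vprod_gen: "S \<subseteq> {..<n} \<Longrightarrow> below n (vprod gen S)"
  by (rule below_vprod) (auto intro: below_gen)

lemma below_trunc: "below n (trunc n x)"
  unfolding trunc_def by (intro below_sum below_const_mult below_vprod_gen) auto

lemma coeff_trunc: "coeff (trunc n x) U = (if U \<subseteq> {..<n} then x U else 0)"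
proof (cases "U \<subseteq> {..<n}")
  case True
  have "coeff (trunc n x) U = (\<Sum>S\<in>Pow {..<n}. if S = U then x U else 0)"
    unfolding trunc_def coeff_sum
    by (intro sum.cong refl) (simp add: coeff_vprod_gen finite_subset_lessThan bvec_def)
  also have "\<dots> = x U" using True by (simp add: sum.delta)
  finally show ?thesis using True by simp
next
  case False
  then show ?thesis using below_trunc[of n x] unfolding below_def by simp
qed

lemma trunc_coeff: "below n x \<Longrightarrow> trunc n (coeff x) = x"
  by (rule ext_eqI) (simp add: coeff_trunc below_def)

lemma trunc_add: "trunc n (\<lambda>S. x S + y S) = trunc n x + trunc n y"
  and trunc_cmult: "trunc n (\<lambda>S. c * x S) = const c * trunc n x"
  by (rule ext_eqI, simp add: coeff_trunc)+

lemma trunc_bvec: "S \<subseteq> {..<n} \<Longrightarrow> trunc n (bvec S) = vprod gen S"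
  by (rule ext_eqI) (auto simp: coeff_trunc coeff_vprod_gen finite_subset_lessThan bvec_def)

lemma trunc_0 [simp]: "trunc n (\<lambda>_. 0) = 0"
  by (rule ext_eqI) (simp add: coeff_trunc)

lemma wedge_cong:
  "(\<And>S. S \<subseteq> U \<Longrightarrow> x S = x' S) \<Longrightarrow> (\<And>S. S \<subseteq> U \<Longrightarrow> y S = y' S) \<Longrightarrow> wedge x y U = wedge x' y' U"
  unfolding wedge_def by (intro sum.cong refl) auto

lemma wedge_trunc:
  assumes "U \<subseteq> {..<n}"
  shows "wedge (coeff x) y U = coeff (x * trunc n y) U"
  unfolding coeff_mult by (rule wedge_cong) (use assms in \<open>auto simp: coeff_trunc\<close>)

text \<open>The value 0 from \<open>n\<close> on keeps every image of degree 1 and in \<Lambda>V, so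
  \<open>extend (lin n M)\<close> is multiplicative and lands in \<Lambda>V whatever its
  argument.\<close>

definition lin :: "nat \<Rightarrow> (nat \<Rightarrow> nat \<Rightarrow> complex) \<Rightarrow> nat \<Rightarrow> ext" where
  "lin n M j = (if j < n then \<Sum>i<n. const (M i j) * gen i else 0)"

lemma homog_lin: "homog 1 (lin n M j)"
  unfolding lin_def by (auto intro!: homog_sum homog_const_mult homog_gen simp del: One_nat_def)

lemma below_lin: "below n (lin n M j)"
  unfolding lin_def by (auto intro!: below_sum below_const_mult below_gen)

lemmas anticommuting_lin = anticommutingI[OF homog_lin]

lemma extend_trunc: "extend v (trunc n x) = (\<Sum>S\<in>Pow {..<n}. const (x S) * vprod v S)"
  unfolding trunc_def extend_sum extend_const_mult
  by (intro sum.cong refl) (simp add: extend_vprod_gen finite_subset_lessThan)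

lemma ext_map_eq: "ext_map n M x = coeff (extend (lin n M) (trunc n x))"
proof
  fix U
  have c: "(\<lambda>T. \<Sum>i<n. M i j * bvec {i} T) = coeff (lin n M j)" if "j < n" for j
    using that by (simp add: fun_eq_iff lin_def coeff_sum gen.rep_eq)
  have "foldr (\<lambda>j. wedge (\<lambda>T. \<Sum>i<n. M i j * bvec {i} T)) xs (bvec {}) = coeff (prod_list (map (lin n M) xs))"
    if "set xs \<subseteq> {..<n}" for xs
    using that by (induction xs) (auto simp: coeff_1 c coeff_mult)
  then have "foldr (\<lambda>j. wedge (\<lambda>T. \<Sum>i<n. M i j * bvec {i} T)) (sorted_list_of_set S) (bvec {}) =
      coeff (vprod (lin n M) S)" if "S \<subseteq> {..<n}" for S
    using that unfolding vprod_def by (simp add: finite_subset_lessThan)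
  then show "ext_map n M x U = coeff (extend (lin n M) (trunc n x)) U"
    unfolding ext_map_def extend_trunc coeff_sum by (intro sum.cong refl) simp
qed

text \<open>The factor in \<Lambda>V of the component at \<open>k\<close>: an element
  \<open>x\<close> of the smash product is the sum of the products of \<open>k\<close> with
  \<open>row n x k\<close>.\<close>

definition row :: "nat \<Rightarrow> ('g idx \<Rightarrow> complex) \<Rightarrow> 'g \<Rightarrow> ext" where
  "row n x k = trunc n (\<lambda>S. x (k, S))"

lemma below_row: "below n (row n x k)"
  by (simp add: row_def below_trunc)

lemma coeff_row: "U \<subseteq> {..<n} \<Longrightarrow> coeff (row n x k) U = x (k, U)"
  by (simp add: row_def coeff_trunc)

lemma row_bvec:
  assumes "S \<subseteq> {..<n}"
  shows "row n (bvec (a, S)) k = (if k = a then vprod gen S else 0)"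
proof -
  have "(\<lambda>T. bvec (a, S) (k, T)) = (if k = a then bvec S else (\<lambda>_. 0))"
    by (auto simp: bvec_def)
  then show ?thesis using assms by (simp add: row_def trunc_bvec)
qed

lemma row_smash:
  "row n (x \<otimes>\<^bsub>smash G n D\<^esub> y) k = (if k \<in> carrier G
    then \<Sum>h\<in>carrier G. extend (lin n (D (inv\<^bsub>G\<^esub> h))) (row n x (k \<otimes>\<^bsub>G\<^esub> inv\<^bsub>G\<^esub> h)) * row n y h else 0)"
proof (cases "k \<in> carrier G")
  case True
  show ?thesis
  proof (rule ext_eqI)
    fix U
    let ?r = "\<Sum>h\<in>carrier G. extend (lin n (D (inv\<^bsub>G\<^esub> h))) (row n x (k \<otimes>\<^bsub>G\<^esub> inv\<^bsub>G\<^esub> h)) * row n y h"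
    have b: "below n ?r"
      by (intro below_sum below_mult below_extend below_lin below_row)
    show "coeff (row n (x \<otimes>\<^bsub>smash G n D\<^esub> y) k) U = coeff (if k \<in> carrier G then ?r else 0) U"
    proof (cases "U \<subseteq> {..<n}")
      case U: True
      then show ?thesis using True
        by (simp add: coeff_row smash_def ext_map_eq wedge_trunc coeff_sum)
          (simp add: row_def wedge_trunc[OF U])
    next
      case False
      then show ?thesis using b below_row[of n "x \<otimes>\<^bsub>smash G n D\<^esub> y" k] True unfolding below_def by simp
    qed
  qed
next
  case False
  then show ?thesis by (simp add: row_def smash_def)
qed

lemma row_one: "row n \<one>\<^bsub>smash G n D\<^esub> k = (if k = \<one>\<^bsub>G\<^esub> then 1 else 0)"
  using row_bvec[of "{}" n "\<one>\<^bsub>G\<^esub>" k] by (simp add: smash_def)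

subsection \<open>The tensor square as the exterior algebra of V + V\<close>

text \<open>The second tensor factor. Its generators come after the \<open>n\<close> generators of
  the first, so a tensor of \<open>a\<close> and \<open>b\<close> in \<Lambda>V is represented by
  \<open>a * shift n b\<close>.\<close>

definition shift :: "nat \<Rightarrow> ext \<Rightarrow> ext" where
  "shift n = extend (\<lambda>j. gen (n + j))"

lemma anticommuting_shift: "anticommuting (\<lambda>j. gen (n + j))"
  by (rule anticommutingI) (rule homog_gen)

lemma homog_shift: "homog k x \<Longrightarrow> homog k (shift n x)"
  unfolding shift_def by (rule homog_extend) (rule homog_gen)

lemma shift_mult: "shift n (x * y) = shift n x * shift n y"
  unfolding shift_def by (rule extend_mult[OF anticommuting_shift])

lemma shift_vprod_gen:
  assumes "finite T"
  shows "shift n (vprod gen T) = vprod gen ((+) n ` T)"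
proof -
  have "sorted_list_of_set ((+) n ` T) = map ((+) n) (sorted_list_of_set T)"
  proof -
    have "sorted_wrt (<) (map ((+) n) (sorted_list_of_set T))"
      using strict_sorted_list_of_set[of T] by (simp add: sorted_wrt_map)
    moreover have "set (map ((+) n) (sorted_list_of_set T)) = (+) n ` T" using assms by simp
    moreover have "length (map ((+) n) (sorted_list_of_set T)) = card ((+) n ` T)"
      by (simp add: card_image)
    ultimately show ?thesis
      using sorted_list_of_set_unique[of "(+) n ` T" "map ((+) n) (sorted_list_of_set T)"] assms by simp
  qed
  then show ?thesis unfolding shift_def extend_vprod_gen[OF assms] by (simp add: vprod_def comp_def)
qed

text \<open>Every index of the first copy precedes every index of the second, so there are no
  inversions and basis tensors become basis vectors without sign.\<close>

lemma vprod_gen_shift: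
  assumes "S \<subseteq> {..<n}" "finite T"
  shows "coeff (vprod gen S * shift n (vprod gen T)) = bvec (S \<union> (+) n ` T)"
proof
  fix U
  let ?T = "(+) n ` T"
  have fS: "finite S" using assms(1) by (rule finite_subset_lessThan)
  have inv0: "inversions S ?T = 0"
  proof -
    have "{(i, j). i \<in> S \<and> j \<in> ?T \<and> j < i} = {}" using assms(1) by fastforce
    then show ?thesis unfolding inversions_def by (simp only: card.empty)
  qed
  have dis: "S \<inter> ?T = {}" using assms(1) by fastforce
  show "coeff (vprod gen S * shift n (vprod gen T)) U = bvec (S \<union> ?T) U"
  proof (cases "finite U")
    case True
    have "coeff (vprod gen S * shift n (vprod gen T)) U =
        (\<Sum>A\<in>Pow U. if A = S then bvec (S \<union> ?T) U else 0)"
      unfolding coeff_mult wedge_eq shift_vprod_gen[OF assms(2)]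
    proof (intro sum.cong refl)
      fix A assume "A \<in> Pow U"
      then have "S \<union> ?T = U \<longleftrightarrow> U - S = ?T" if "A = S" using that dis by auto
      then show "(-1) ^ inversions A (U - A) * coeff (vprod gen S) A * coeff (vprod gen ?T) (U - A) =
          (if A = S then bvec (S \<union> ?T) U else 0)"
        using inv0 by (auto simp: coeff_vprod_gen fS assms(2) bvec_def)
    qed
    also have "\<dots> = bvec (S \<union> ?T) U" using True by (auto simp: sum.delta bvec_def)
    finally show ?thesis .
  next
    case False
    then have "U \<noteq> S \<union> ?T" using fS assms(2) by auto
    then show ?thesis using False by (simp add: coeff_infinite bvec_def)
  qed
qed

text \<open>The coefficient in \<Lambda>(V + V) of the group-like tensor k \<otimes> l written on
  the left. Group elements are even, so splitting them off creates no sign.\<close>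

definition blk :: "nat \<Rightarrow> ('g idx \<times> 'g idx \<Rightarrow> complex) \<Rightarrow> 'g \<Rightarrow> 'g \<Rightarrow> ext" where
  "blk n X k l = (\<Sum>S\<in>Pow {..<n}. \<Sum>T\<in>Pow {..<n}.
     const (X ((k, S), (l, T))) * (vprod gen S * shift n (vprod gen T)))"

lemma Un_shift_eq_iff:
  fixes n :: nat
  assumes "S \<subseteq> {..<n}" "S' \<subseteq> {..<n}"
  shows "S \<union> (+) n ` T = S' \<union> (+) n ` T' \<longleftrightarrow> S = S' \<and> T = T'"
proof
  assume eq: "S \<union> (+) n ` T = S' \<union> (+) n ` T'"
  have "(S \<union> (+) n ` T) \<inter> {..<n} = S" "(S' \<union> (+) n ` T') \<inter> {..<n} = S'"
    using assms by auto
  moreover have "{i. n + i \<in> S \<union> (+) n ` T} = T" "{i. n + i \<in> S' \<union> (+) n ` T'} = T'" using assms by auto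
  ultimately show "S = S' \<and> T = T'" using eq by metis
qed auto

lemma coeff_blk:
  assumes "S \<subseteq> {..<n}" "T \<subseteq> {..<n}"
  shows "coeff (blk n X k l) (S \<union> (+) n ` T) = X ((k, S), (l, T))"
proof -
  have "coeff (blk n X k l) (S \<union> (+) n ` T) =
      (\<Sum>A\<in>Pow {..<n}. \<Sum>B\<in>Pow {..<n}. if B = T then (if A = S then X ((k, S), (l, T)) else 0) else 0)"
    unfolding blk_def coeff_sum
  proof (intro sum.cong refl)
    fix A B assume "A \<in> Pow {..<n}" "B \<in> Pow {..<n}"
    then have AB: "A \<subseteq> {..<n}" "finite B" using finite_subset_lessThan by auto
    show "coeff (const (X ((k, A), (l, B))) * (vprod gen A * shift n (vprod gen B))) (S \<union> (+) n ` T) =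
        (if B = T then (if A = S then X ((k, S), (l, T)) else 0) else 0)"
      unfolding coeff_const_mult vprod_gen_shift[OF AB] bvec_def
      using Un_shift_eq_iff[OF assms(1) AB(1), of T B] by auto
  qed
  also have "\<dots> = X ((k, S), (l, T))" using assms by (simp add: sum.delta)
  finally show ?thesis .
qed

lemma below_shift:
  assumes "below n x"
  shows "below (2 * n) (shift n x)"
  unfolding shift_def below_expand[OF assms]
  by (auto intro!: below_sum below_const_mult below_vprod below_gen)

lemma below_blk: "below (2 * n) (blk n X k l)"
  unfolding blk_def
  by (intro below_sum below_const_mult below_mult below_shift below_mono[of n _ "2 * n"] below_vprod_gen) auto

lemma blk_eqD: "blk n X k l = blk n Y k l \<Longrightarrow> S \<subseteq> {..<n} \<Longrightarrow> T \<subseteq> {..<n} \<Longrightarrow>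
    X ((k, S), (l, T)) = Y ((k, S), (l, T))"
  by (metis coeff_blk)

lemma blk_add: "blk n (\<lambda>p. X p + Y p) k l = blk n X k l + blk n Y k l"
  by (simp add: blk_def const_add distrib_right sum.distrib)

lemma blk_cmult: "blk n (\<lambda>p. c * X p) k l = const c * blk n X k l"
  by (simp add: blk_def const_mult sum_distrib_left mult.assoc)

lemma blk_diff: "blk n (\<lambda>p. X p - Y p) k l = blk n X k l - blk n Y k l"
  using blk_add[of n X "\<lambda>p. -1 * Y p" k l] blk_cmult[of n "-1" Y k l] by (simp add: const_minus)

lemma blk_0: "blk n (\<lambda>p. 0) k l = 0"
  by (simp add: blk_def)

lemma blk_sum: "blk n (\<lambda>p. \<Sum>a\<in>A. F a p) k l = (\<Sum>a\<in>A. blk n (F a) k l)"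
  by (induction A rule: infinite_finite_induct) (simp_all add: blk_0 blk_add)

lemma blk_tens: "blk n (tens x y) k l = row n x k * shift n (row n y l)"
  unfolding row_def shift_def extend_trunc
proof -
  have c: "const a * v * (const b * w) = const (a * b) * (v * w)" for a b v w
    by (simp add: const_mult mult.assoc mult_const_left_commute[of v])
  show "blk n (tens x y) k l = trunc n (\<lambda>S. x (k, S)) *
      (\<Sum>S\<in>Pow {..<n}. const (y (l, S)) * vprod (\<lambda>j. gen (n + j)) S)"
    unfolding trunc_def blk_def tens_def sum_product c shift_def
    by (intro sum.cong refl) (simp add: extend_vprod_gen finite_subset_lessThan)
qed

section \<open>Pairs of linear maps acting on the two copies of V\<close>

definition lin2 :: "nat \<Rightarrow> (nat \<Rightarrow> nat \<Rightarrow> complex) \<Rightarrow> (nat \<Rightarrow> nat \<Rightarrow> complex) \<Rightarrow> nat \<Rightarrow> ext" where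
  "lin2 n M N j = (if j < n then lin n M j else shift n (lin n N (j - n)))"

lemma homog_lin2: "homog 1 (lin2 n M N j)"
  by (simp add: lin2_def homog_lin homog_shift del: One_nat_def)

lemmas anticommuting_lin2 = anticommutingI[OF homog_lin2]



lemma extend_lin2_left:
  assumes "below n x"
  shows "extend (lin2 n M N) x = extend (lin n M) x"
proof (rule extend_cong)
  fix S i assume "coeff x S \<noteq> 0" "i \<in> S"
  then have "i < n" using assms unfolding below_def by auto
  then show "lin2 n M N i = lin n M i" by (simp add: lin2_def)
qed

lemma extend_lin2_shift: "extend (lin2 n M N) (shift n y) = shift n (extend (lin n N) y)"
  unfolding shift_def extend_extend[OF anticommuting_lin2] extend_extend[OF anticommuting_shift]
  by (simp add: lin2_def shift_def)

lemma extend_lin2_tensor: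
  assumes "below n x"
  shows "extend (lin2 n M N) (x * shift n y) = extend (lin n M) x * shift n (extend (lin n N) y)"
  by (simp add: extend_mult[OF anticommuting_lin2] extend_lin2_left[OF assms] extend_lin2_shift)

lemma extend_blk:
  "extend (lin2 n M N) (blk n X k l) = (\<Sum>S\<in>Pow {..<n}. \<Sum>T\<in>Pow {..<n}. const (X ((k, S), (l, T))) *
     (extend (lin n M) (vprod gen S) * shift n (extend (lin n N) (vprod gen T))))"
  unfolding blk_def extend_sum extend_const_mult
  by (intro sum.cong refl) (simp add: extend_lin2_tensor below_vprod_gen)

lemma extend_id_below:
  assumes "below n x" "\<And>i. i < n \<Longrightarrow> v i = gen i"
  shows "extend v x = x"
proof -
  have "extend v x = extend gen x"
  proof (rule extend_cong)
    fix S i assume "coeff x S \<noteq> 0" "i \<in> S"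
    then show "v i = gen i" using assms unfolding below_def by auto
  qed
  then show ?thesis by (simp add: extend_gen_id)
qed

lemma lin_id:
  assumes "\<And>i j. i < n \<Longrightarrow> j < n \<Longrightarrow> M i j = (if i = j then 1 else 0)" "j < n"
  shows "lin n M j = gen j"
proof -
  have "lin n M j = (\<Sum>i<n. if i = j then gen j else 0)"
  proof -
    have "const (M i j) * gen i = (if i = j then gen j else 0)" if "i \<in> {..<n}" for i
      using that assms by simp
    then show ?thesis using assms(2) by (simp add: lin_def)
  qed
  then show ?thesis using assms(2) by simp
qed

lemma extend_lin2_id:
  assumes "\<And>i j. i < n \<Longrightarrow> j < n \<Longrightarrow> M i j = (if i = j then 1 else 0)" "below (2 * n) x"
  shows "extend (lin2 n M M) x = x"
proof (rule extend_id_below[OF assms(2)])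
  fix i assume "i < 2 * n"
  then show "lin2 n M M i = gen i"
    using lin_id[of n M i] lin_id[of n M "i - n"] assms(1) by (simp add: lin2_def shift_def)
qed

lemma row_smash_bvec:
  assumes "group G" "finite (carrier G)" "a \<in> carrier G" "c \<in> carrier G" "S \<subseteq> {..<n}" "T \<subseteq> {..<n}"
  shows "row n (bvec (a, S) \<otimes>\<^bsub>smash G n D\<^esub> bvec (c, T)) k =
    (if k = a \<otimes>\<^bsub>G\<^esub> c then extend (lin n (D (inv\<^bsub>G\<^esub> c))) (vprod gen S) * vprod gen T else 0)"
proof (cases "k \<in> carrier G")
  case True
  interpret group G by fact
  have eq: "k \<otimes>\<^bsub>G\<^esub> inv\<^bsub>G\<^esub> c = a \<longleftrightarrow> k = a \<otimes>\<^bsub>G\<^esub> c"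
    using True assms(3,4) by (metis inv_closed inv_solve_right')
  have "row n (bvec (a, S) \<otimes>\<^bsub>smash G n D\<^esub> bvec (c, T)) k = (\<Sum>h\<in>carrier G. if h = c then
      extend (lin n (D (inv\<^bsub>G\<^esub> c))) (row n (bvec (a, S)) (k \<otimes>\<^bsub>G\<^esub> inv\<^bsub>G\<^esub> c)) * vprod gen T else 0)"
  proof -
    have "extend (lin n (D (inv\<^bsub>G\<^esub> h))) (row n (bvec (a, S)) (k \<otimes>\<^bsub>G\<^esub> inv\<^bsub>G\<^esub> h)) * row n (bvec (c, T)) h =
      (if h = c then extend (lin n (D (inv\<^bsub>G\<^esub> c))) (row n (bvec (a, S)) (k \<otimes>\<^bsub>G\<^esub> inv\<^bsub>G\<^esub> c)) * vprod gen T else 0)"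
      for h by (simp add: row_bvec[OF assms(6)])
    then show ?thesis using True by (simp only: row_smash if_True)
  qed
  also have "\<dots> = extend (lin n (D (inv\<^bsub>G\<^esub> c))) (row n (bvec (a, S)) (k \<otimes>\<^bsub>G\<^esub> inv\<^bsub>G\<^esub> c)) * vprod gen T"
    using assms by (simp add: sum.delta)
  finally show ?thesis using assms by (simp add: row_bvec eq)
next
  case False
  interpret group G by fact
  have "k \<noteq> a \<otimes>\<^bsub>G\<^esub> c" using False assms by auto
  then show ?thesis using False by (simp add: row_smash)
qed

section \<open>Multiplication in the tensor square by blocks\<close>

lemma sum_idx: "(\<Sum>a\<in>idx G n. f a) = (\<Sum>g\<in>carrier G. \<Sum>S\<in>Pow {..<n}. f (g, S))"
  by (simp add: idx_def sum.cartesian_product)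

lemma sum_idx2: "(\<Sum>p\<in>idx G n \<times> idx G n. f p) =
    (\<Sum>g\<in>carrier G. \<Sum>h\<in>carrier G. \<Sum>S\<in>Pow {..<n}. \<Sum>T\<in>Pow {..<n}. f ((g, S), (h, T)))"
proof -
  have "(\<Sum>p\<in>idx G n \<times> idx G n. f p) = (\<Sum>a\<in>idx G n. \<Sum>b\<in>idx G n. f (a, b))"
    by (simp add: sum.cartesian_product)
  also have "\<dots> = (\<Sum>g\<in>carrier G. \<Sum>S\<in>Pow {..<n}. \<Sum>h\<in>carrier G. \<Sum>T\<in>Pow {..<n}. f ((g, S), (h, T)))"
    by (simp add: sum_idx)
  also have "\<dots> = (\<Sum>g\<in>carrier G. \<Sum>h\<in>carrier G. \<Sum>S\<in>Pow {..<n}. \<Sum>T\<in>Pow {..<n}. f ((g, S), (h, T)))"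
    by (rule sum.cong[OF refl]) (rule sum.swap)
  finally show ?thesis .
qed

locale smash_product = group G for G :: "('g, 'm) monoid_scheme" (structure) +
  fixes n :: nat and D :: "'g \<Rightarrow> nat \<Rightarrow> nat \<Rightarrow> complex"
  assumes finite_carrier: "finite (carrier G)"
    and D_one: "\<And>i j. i < n \<Longrightarrow> j < n \<Longrightarrow> D \<one> i j = (if i = j then 1 else 0)"
begin

text \<open>The effect of moving an element of \<Lambda>(V + V) to the right past g \<otimes> h:
  each copy of V is acted on by the inverse of its group element.\<close>

abbreviation "\<Lambda> g h \<equiv> extend (lin2 n (D (inv g)) (D (inv h)))"

lemma tensor_swap:
  assumes "S2 \<subseteq> {..<n}" "T \<subseteq> {..<n}"
  shows "vprod gen S2 * shift n (extend (lin n M) (vprod gen T)) =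
    const ((-1) ^ (card T * card S2)) * (shift n (extend (lin n M) (vprod gen T)) * vprod gen S2)"
proof -
  have "homog (card T) (extend (lin n M) (vprod gen T))"
    using assms by (intro homog_extend homog_lin homog_vprod homog_gen finite_subset_lessThan)
  then have "homog (card T) (shift n (extend (lin n M) (vprod gen T)))" by (rule homog_shift)
  moreover have "homog (card S2) (vprod gen S2)"
    using assms by (intro homog_vprod homog_gen finite_subset_lessThan)
  ultimately show ?thesis by (subst homog_supercommute) (simp_all add: mult.commute)
qed

text \<open>The sign of the super multiplication is exactly the sign of moving a second-copy product
  past a first-copy product in \<Lambda>(V + V). So in blocks the tensor square is the smash product
  of G \<times> G with an exterior algebra, with no explicit sign left.\<close>

lemma blk_smash2:
  assumes "k \<in> carrier G" "l \<in> carrier G"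
  shows "blk n (X \<otimes>\<^bsub>smash2 G n D\<^esub> Y) k l =
    (\<Sum>g\<in>carrier G. \<Sum>h\<in>carrier G. \<Lambda> g h (blk n X (k \<otimes> inv g) (l \<otimes> inv h)) * blk n Y g h)"
proof -
  let ?I = "idx G n \<times> idx G n"
  let ?s = "\<lambda>a b c d. (-1) ^ (card (snd b) * card (snd c)) * X (a, b) * Y (c, d)"
  let ?t = "\<lambda>a b c d. row n (bvec a \<otimes>\<^bsub>smash G n D\<^esub> bvec c) k *
      shift n (row n (bvec b \<otimes>\<^bsub>smash G n D\<^esub> bvec d) l)"
  have cd: "(\<Sum>(a, b)\<in>?I. const (?s a b (g, S2) (h, T2)) * ?t a b (g, S2) (h, T2)) =
      \<Lambda> g h (blk n X (k \<otimes> inv g) (l \<otimes> inv h)) *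
      (const (Y ((g, S2), (h, T2))) * (vprod gen S2 * shift n (vprod gen T2)))"
    if gh: "g \<in> carrier G" "h \<in> carrier G" and ST: "S2 \<in> Pow {..<n}" "T2 \<in> Pow {..<n}" for g h S2 T2
  proof -
    let ?E = "\<lambda>S. extend (lin n (D (inv g))) (vprod gen S)"
    let ?F = "\<lambda>T. shift n (extend (lin n (D (inv h))) (vprod gen T))"
    let ?Z = "\<lambda>S T. const (?s (k \<otimes> inv g, S) (l \<otimes> inv h, T) (g, S2) (h, T2)) *
        (?E S * vprod gen S2 * (?F T * shift n (vprod gen T2)))"
    have eq: "k = a \<otimes> g \<longleftrightarrow> a = k \<otimes> inv g" "l = a \<otimes> h \<longleftrightarrow> a = l \<otimes> inv h" if "a \<in> carrier G" for a
      using that gh assms by (metis inv_closed inv_solve_right')+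
    have "(\<Sum>(a, b)\<in>?I. const (?s a b (g, S2) (h, T2)) * ?t a b (g, S2) (h, T2)) =
        (\<Sum>a\<in>carrier G. \<Sum>b\<in>carrier G. if b = l \<otimes> inv h then
          (if a = k \<otimes> inv g then \<Sum>S\<in>Pow {..<n}. \<Sum>T\<in>Pow {..<n}. ?Z S T else 0) else 0)"
      unfolding sum_idx2
    proof (intro sum.cong refl)
      fix a b assume ab: "a \<in> carrier G" "b \<in> carrier G"
      have "?t (a, S) (b, T) (g, S2) (h, T2) = (if b = l \<otimes> inv h then
          (if a = k \<otimes> inv g then ?E S * vprod gen S2 * (?F T * shift n (vprod gen T2)) else 0) else 0)"
        if "S \<in> Pow {..<n}" "T \<in> Pow {..<n}" for S T
        using that ab gh ST
        by (simp add: row_smash_bvec is_group finite_carrier eq shift_mult)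
          (simp add: shift_def)
      then show "(\<Sum>S\<in>Pow {..<n}. \<Sum>T\<in>Pow {..<n}. case ((a, S), (b, T)) of (a, b) \<Rightarrow>
          const (?s a b (g, S2) (h, T2)) * ?t a b (g, S2) (h, T2)) =
        (if b = l \<otimes> inv h then
          (if a = k \<otimes> inv g then \<Sum>S\<in>Pow {..<n}. \<Sum>T\<in>Pow {..<n}. ?Z S T else 0) else 0)"
        by simp
    qed
    also have "\<dots> = (\<Sum>S\<in>Pow {..<n}. \<Sum>T\<in>Pow {..<n}. ?Z S T)"
      using finite_carrier gh assms by (simp add: sum.delta)
    also have "\<dots> = (\<Sum>S\<in>Pow {..<n}. \<Sum>T\<in>Pow {..<n}. const (X ((k \<otimes> inv g, S), (l \<otimes> inv h, T))) * (?E S * ?F T) *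
        (const (Y ((g, S2), (h, T2))) * (vprod gen S2 * shift n (vprod gen T2))))"
    proof (intro sum.cong refl)
      fix S T assume "S \<in> Pow {..<n}" "T \<in> Pow {..<n}"
      then have sw: "vprod gen S2 * ?F T = const ((-1) ^ (card T * card S2)) * (?F T * vprod gen S2)"
        using ST by (intro tensor_swap) auto
      let ?e = "(-1::complex) ^ (card T * card S2)"
      let ?x = "X ((k \<otimes> inv g, S), (l \<otimes> inv h, T))"
      let ?y = "Y ((g, S2), (h, T2))"
      have "?Z S T = const (?e * ?x * ?y) * (?E S * (vprod gen S2 * ?F T) * shift n (vprod gen T2))"
        by (simp add: mult.assoc)
      also have "\<dots> = const (?e * ?x * ?y * ?e) * (?E S * (?F T * vprod gen S2) * shift n (vprod gen T2))"
        unfolding sw by (simp only: mult_const_left_commute[of "?E S"] const_mult mult.assoc)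
      \<comment> \<open>One sign comes from the super multiplication, the other from reordering the
        generators; they cancel.\<close>
      also have "?e * ?x * ?y * ?e = ?x * ?y"
      proof -
        have "?e * ?e = 1" by (simp flip: power_mult_distrib)
        then show ?thesis by (simp add: mult.commute mult.left_commute)
      qed
      also have "const (?x * ?y) * (?E S * (?F T * vprod gen S2) * shift n (vprod gen T2)) =
          const ?x * (?E S * ?F T) * (const ?y * (vprod gen S2 * shift n (vprod gen T2)))"
        by (simp only: mult_const_left_commute[of "const ?x * (?E S * ?F T)"])
          (simp only: const_mult[symmetric] mult.assoc[symmetric] mult.commute[of ?y])
      finally show "?Z S T = const ?x * (?E S * ?F T) * (const ?y * (vprod gen S2 * shift n (vprod gen T2)))" .
    qed
    also have "\<dots> = \<Lambda> g h (blk n X (k \<otimes> inv g) (l \<otimes> inv h)) *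
      (const (Y ((g, S2), (h, T2))) * (vprod gen S2 * shift n (vprod gen T2)))"
      unfolding extend_blk sum_distrib_right by simp
    finally show ?thesis .
  qed
  have "blk n (X \<otimes>\<^bsub>smash2 G n D\<^esub> Y) k l =
      (\<Sum>(a, b)\<in>?I. \<Sum>(c, d)\<in>?I. const (?s a b c d) * ?t a b c d)"
    by (simp add: smash2_def blk_sum case_prod_beta blk_cmult blk_tens)
  also have "\<dots> = (\<Sum>(c, d)\<in>?I. \<Sum>(a, b)\<in>?I. const (?s a b c d) * ?t a b c d)"
    unfolding case_prod_beta by (rule sum.swap)
  also have "\<dots> = (\<Sum>g\<in>carrier G. \<Sum>h\<in>carrier G. \<Sum>S2\<in>Pow {..<n}. \<Sum>T2\<in>Pow {..<n}.
      \<Lambda> g h (blk n X (k \<otimes> inv g) (l \<otimes> inv h)) *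
      (const (Y ((g, S2), (h, T2))) * (vprod gen S2 * shift n (vprod gen T2))))"
  proof -
    have "(\<Sum>(c, d)\<in>?I. \<Sum>(a, b)\<in>?I. const (?s a b c d) * ?t a b c d) =
        (\<Sum>(c, d)\<in>?I. \<Lambda> (fst c) (fst d) (blk n X (k \<otimes> inv (fst c)) (l \<otimes> inv (fst d))) *
          (const (Y (c, d)) * (vprod gen (snd c) * shift n (vprod gen (snd d)))))"
    proof (rule sum.cong[OF refl])
      fix q assume "q \<in> ?I"
      then obtain g S2 h T2 where q: "q = ((g, S2), (h, T2))" "g \<in> carrier G" "h \<in> carrier G"
        "S2 \<in> Pow {..<n}" "T2 \<in> Pow {..<n}" unfolding idx_def by auto
      show "(case q of (c, d) \<Rightarrow> \<Sum>(a, b)\<in>?I. const (?s a b c d) * ?t a b c d) =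
        (case q of (c, d) \<Rightarrow> \<Lambda> (fst c) (fst d) (blk n X (k \<otimes> inv (fst c)) (l \<otimes> inv (fst d))) *
          (const (Y (c, d)) * (vprod gen (snd c) * shift n (vprod gen (snd d)))))"
        using cd[OF q(2-5)] unfolding q(1) by (simp only: prod.case fst_conv snd_conv)
    qed
    then show ?thesis unfolding sum_idx2 by (simp only: prod.case fst_conv snd_conv)
  qed
  also have "\<dots> = (\<Sum>g\<in>carrier G. \<Sum>h\<in>carrier G. \<Lambda> g h (blk n X (k \<otimes> inv g) (l \<otimes> inv h)) * blk n Y g h)"
    by (simp only: sum_distrib_left[symmetric] blk_def[symmetric])
  finally show ?thesis .
qed

end

subsection \<open>The twisted coproduct\<close>

lemma wedge_outside:
  assumes "below n x" "\<And>S. \<not> S \<subseteq> {..<n} \<Longrightarrow> y S = 0" "\<not> U \<subseteq> {..<n}"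
  shows "wedge (coeff x) y U = 0"
  unfolding wedge_eq
proof (intro sum.neutral ballI)
  fix S assume "S \<in> Pow U"
  then have "\<not> S \<subseteq> {..<n} \<or> \<not> U - S \<subseteq> {..<n}" using assms(3) by blast
  then have "coeff x S = 0 \<or> y (U - S) = 0" using assms(1,2) unfolding below_def by blast
  then show "(-1) ^ inversions S (U - S) * coeff x S * y (U - S) = 0" by auto
qed

text \<open>The left factor enters through \<open>ext_map\<close>, whose values always lie in
  \<Lambda>V, so the support of \<open>y\<close> decides.\<close>

lemma smash_mult_in_supp_space:
  assumes "y \<in> supp_space (idx G n)"
  shows "x \<otimes>\<^bsub>smash G n D\<^esub> y \<in> supp_space (idx G n)"
  unfolding supp_space_def
proof (clarify)
  fix k U assume kU: "(k, U) \<notin> idx G n"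
  show "(x \<otimes>\<^bsub>smash G n D\<^esub> y) (k, U) = 0"
  proof (cases "k \<in> carrier G")
    case True
    then have U: "\<not> U \<subseteq> {..<n}" using kU by (auto simp: idx_def)
    have "y (h, S) = 0" if "\<not> S \<subseteq> {..<n}" for h S
      using assms that by (simp add: supp_space_def idx_def)
    then have "wedge (ext_map n M z) (\<lambda>S. y (h, S)) U = 0" for M z h
      unfolding ext_map_eq by (intro wedge_outside[OF below_extend[OF below_lin] _ U]) auto
    then show ?thesis by (simp add: smash_def)
  qed (simp add: smash_def)
qed

lemma supp_spaceD: "x \<in> supp_space I \<Longrightarrow> p \<notin> I \<Longrightarrow> x p = 0"
  by (simp add: supp_space_def)

lemma carrier_smash2: "carrier (smash2 G n D) = supp_space (idx G n \<times> idx G n)"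
  by (simp add: smash2_def)

lemma bvec_in_supp_space: "a \<in> I \<Longrightarrow> bvec a \<in> supp_space I"
  by (auto simp: supp_space_def bvec_def)

lemma tens_in_supp_space: "x \<in> supp_space I \<Longrightarrow> y \<in> supp_space K \<Longrightarrow> tens x y \<in> supp_space (I \<times> K)"
  by (auto simp: supp_space_def tens_def)

text \<open>\<open>X\<close> and \<open>Y\<close> are arbitrary because the product is a combination
  of products of basis tensors with indices in \<open>idx G n\<close>.\<close>

lemma smash2_mult_closed: "X \<otimes>\<^bsub>smash2 G n D\<^esub> Y \<in> carrier (smash2 G n D)"
proof -
  have "tens (bvec a \<otimes>\<^bsub>smash G n D\<^esub> bvec c) (bvec b \<otimes>\<^bsub>smash G n D\<^esub> bvec d) p = 0"
    if "c \<in> idx G n" "d \<in> idx G n" "p \<notin> idx G n \<times> idx G n" for a b c d p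
    using tens_in_supp_space[OF smash_mult_in_supp_space[OF bvec_in_supp_space[OF that(1)]]
        smash_mult_in_supp_space[OF bvec_in_supp_space[OF that(2)]]] that(3)
    unfolding supp_space_def by blast
  then show ?thesis
    by (auto simp: smash2_def supp_space_def intro!: sum.neutral)
qed

text \<open>The tensor B as an element of degree 2 of \<Lambda>(V + V): its left factors in the
  first copy of V, its right factors in the second.\<close>

definition quad :: "nat \<Rightarrow> (nat \<Rightarrow> nat \<Rightarrow> complex) \<Rightarrow> ext" where
  "quad n B = (\<Sum>i<n. \<Sum>j<n. const (B i j) * (gen i * gen (n + j)))"

text \<open>In matrix notation M B M^T, which is the action of M on the tensor B.\<close>

definition congr :: "nat \<Rightarrow> (nat \<Rightarrow> nat \<Rightarrow> complex) \<Rightarrow> (nat \<Rightarrow> nat \<Rightarrow> complex) \<Rightarrow> nat \<Rightarrow> nat \<Rightarrow> complex" where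
  "congr n M B a b = (\<Sum>i<n. \<Sum>j<n. M a i * B i j * M b j)"

lemma homog_quad: "homog 2 (quad n B)"
proof -
  have "homog 2 (gen i * gen (n + j))" for i j
    using homog_mult[OF homog_gen[of i] homog_gen[of "n + j"]] by (simp add: numeral_2_eq_2)
  then show ?thesis unfolding quad_def by (intro homog_sum homog_const_mult)
qed

lemma below_quad: "below (2 * n) (quad n B)"
  unfolding quad_def by (intro below_sum below_const_mult below_mult below_gen) auto

lemma quad_cong: "(\<And>i j. i < n \<Longrightarrow> j < n \<Longrightarrow> B i j = C i j) \<Longrightarrow> quad n B = quad n C"
  by (simp add: quad_def)

lemma quad_diff: "quad n (\<lambda>i j. B i j - C i j) = quad n B - quad n C"
proof -
  have "const (a - b) * z = const a * z - const b * z" for a b z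
    using const_add[of a "- b"] const_minus[of b] by (simp add: left_diff_distrib)
  then show ?thesis by (simp add: quad_def sum_subtractf)
qed

lemma extend_quad: "extend (lin2 n M M) (quad n B) = quad n (congr n M B)"
proof -
  have gen: "extend (lin2 n M M) (gen i * gen (n + j)) =
      (\<Sum>a<n. \<Sum>b<n. const (M a i * M b j) * (gen a * gen (n + b)))" if "i < n" "j < n" for i j
  proof -
    have "extend (lin2 n M M) (gen i * gen (n + j)) = lin n M i * shift n (lin n M j)"
      using that by (simp add: extend_mult[OF anticommuting_lin2] lin2_def)
    also have "\<dots> = (\<Sum>a<n. const (M a i) * gen a) * (\<Sum>b<n. const (M b j) * gen (n + b))"
      using that by (simp add: lin_def shift_def extend_sum extend_const_mult)
    also have "\<dots> = (\<Sum>a<n. \<Sum>b<n. const (M a i * M b j) * (gen a * gen (n + b)))"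
      unfolding sum_product
      by (intro sum.cong refl) (simp add: const_mult mult.assoc mult_const_left_commute[of "gen _"])
    finally show ?thesis .
  qed
  have "extend (lin2 n M M) (quad n B) =
      (\<Sum>i<n. \<Sum>j<n. \<Sum>a<n. \<Sum>b<n. const (M a i * B i j * M b j) * (gen a * gen (n + b)))"
    unfolding quad_def extend_sum extend_const_mult
    by (intro sum.cong refl)
      (simp add: gen sum_distrib_left mult.assoc[symmetric] const_mult[symmetric], simp add: mult_ac)
  also have "\<dots> = (\<Sum>i<n. \<Sum>a<n. \<Sum>j<n. \<Sum>b<n. const (M a i * B i j * M b j) * (gen a * gen (n + b)))"
    by (rule sum.cong[OF refl], rule sum.swap)
  also have "\<dots> = (\<Sum>a<n. \<Sum>i<n. \<Sum>j<n. \<Sum>b<n. const (M a i * B i j * M b j) * (gen a * gen (n + b)))"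
    by (rule sum.swap)
  also have "\<dots> = (\<Sum>a<n. \<Sum>i<n. \<Sum>b<n. \<Sum>j<n. const (M a i * B i j * M b j) * (gen a * gen (n + b)))"
    by (rule sum.cong[OF refl], rule sum.cong[OF refl], rule sum.swap)
  also have "\<dots> = (\<Sum>a<n. \<Sum>b<n. \<Sum>i<n. \<Sum>j<n. const (M a i * B i j * M b j) * (gen a * gen (n + b)))"
    by (rule sum.cong[OF refl], rule sum.swap)
  also have "\<dots> = quad n (congr n M B)"
    by (simp add: quad_def congr_def const_sum sum_distrib_right)
  finally show ?thesis .
qed

text \<open>The primitive coproduct of a basis vector, so that \<open>extend (diag n)\<close> is the
  coproduct of \<Lambda>V with values in \<Lambda>(V + V).\<close>

definition diag :: "nat \<Rightarrow> nat \<Rightarrow> ext" where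
  "diag n j = (if j < n then gen j + gen (n + j) else 0)"

lemma homog_diag: "homog 1 (diag n j)"
  unfolding diag_def using homog_add[OF homog_gen homog_gen] by simp

lemmas anticommuting_diag = anticommutingI[OF homog_diag]

text \<open>Naturality of the coproduct of \<Lambda>V under linear maps of V. The same matrix has to
  act on both copies.\<close>

lemma extend_diag: "extend (lin2 n M M) (extend (diag n) z) = extend (diag n) (extend (lin n M) z)"
proof -
  have "extend (lin2 n M M) (diag n j) = extend (diag n) (lin n M j)" for j
  proof (cases "j < n")
    case True
    have "extend (diag n) (lin n M j) = (\<Sum>i<n. const (M i j) * (gen i + gen (n + i)))"
      using True by (simp add: lin_def extend_sum extend_const_mult diag_def)
    also have "\<dots> = lin n M j + shift n (lin n M j)"
      using True by (simp add: lin_def shift_def extend_sum extend_const_mult distrib_left sum.distrib)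
    finally show ?thesis using True by (simp add: diag_def extend_add lin2_def)
  qed (simp add: diag_def lin_def)
  then show ?thesis by (simp add: extend_extend anticommuting_lin2 anticommuting_diag)
qed

section \<open>The twist and the coproducts in blocks\<close>

context smash_product
begin

text \<open>Among the blocks over G only the one at the identity survives: \<open>X\<close>
  represents the element \<open>x\<close> of the subalgebra \<Lambda>V \<otimes> \<Lambda>V.\<close>

definition at_one :: "('g idx \<times> 'g idx \<Rightarrow> complex) \<Rightarrow> ext \<Rightarrow> bool" where
  "at_one X x \<longleftrightarrow> (\<forall>k\<in>carrier G. \<forall>l\<in>carrier G. blk n X k l = (if k = \<one> \<and> l = \<one> then x else 0))"

lemma at_oneD: "at_one X x \<Longrightarrow> k \<in> carrier G \<Longrightarrow> l \<in> carrier G \<Longrightarrow>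
    blk n X k l = (if k = \<one> \<and> l = \<one> then x else 0)"
  by (simp add: at_one_def)

lemma sum_pair_delta:
  assumes "a \<in> carrier G" "b \<in> carrier G"
    "\<And>g h. g \<in> carrier G \<Longrightarrow> h \<in> carrier G \<Longrightarrow> \<not> (g = a \<and> h = b) \<Longrightarrow> F g h = (0 :: ext)"
  shows "(\<Sum>g\<in>carrier G. \<Sum>h\<in>carrier G. F g h) = F a b"
proof -
  have "(\<Sum>g\<in>carrier G. \<Sum>h\<in>carrier G. F g h) =
      (\<Sum>g\<in>carrier G. \<Sum>h\<in>carrier G. if h = b then if g = a then F a b else 0 else 0)"
    using assms(3) by (intro sum.cong refl) auto
  then show ?thesis using assms(1,2) finite_carrier by (simp add: sum.delta)
qed

text \<open>Group labels are written on the left, so a left factor from \<Lambda>V \<otimes>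
  \<Lambda>V must be moved past k \<otimes> l and is acted on; a right factor, as in
  \<open>blk_mult_at_one\<close>, is simply multiplied.\<close>

lemma blk_at_one_mult:
  assumes "at_one X x" "k \<in> carrier G" "l \<in> carrier G"
  shows "blk n (X \<otimes>\<^bsub>smash2 G n D\<^esub> Y) k l = \<Lambda> k l x * blk n Y k l"
proof -
  have 1: "a \<otimes> inv g = \<one> \<longleftrightarrow> g = a" if "a \<in> carrier G" "g \<in> carrier G" for a g
    using that by (metis inv_closed inv_inv inv_equality r_inv)
  show ?thesis unfolding blk_smash2[OF assms(2,3)]
    using assms by (subst sum_pair_delta[of k l]) (auto simp: at_oneD 1)
qed

lemma blk_mult_at_one:
  assumes "at_one Y y" "k \<in> carrier G" "l \<in> carrier G"
  shows "blk n (X \<otimes>\<^bsub>smash2 G n D\<^esub> Y) k l = blk n X k l * y"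
proof -
  have "\<Lambda> \<one> \<one> (blk n X k l) = blk n X k l"
    by (rule extend_lin2_id) (simp_all add: D_one below_blk)
  then show ?thesis unfolding blk_smash2[OF assms(2,3)]
    using assms by (subst sum_pair_delta[of \<one> \<one>]) (auto simp: at_oneD)
qed

lemma blk_group_mult:
  assumes "\<And>k l. k \<in> carrier G \<Longrightarrow> l \<in> carrier G \<Longrightarrow> blk n X k l = (if k = a \<and> l = b then 1 else 0)"
    "a \<in> carrier G" "b \<in> carrier G" "k \<in> carrier G" "l \<in> carrier G"
  shows "blk n (X \<otimes>\<^bsub>smash2 G n D\<^esub> Y) k l = blk n Y (inv a \<otimes> k) (inv b \<otimes> l)"
proof -
  have 1: "k \<otimes> inv g = a \<longleftrightarrow> g = inv a \<otimes> k" if "a \<in> carrier G" "k \<in> carrier G" "g \<in> carrier G" for a k g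
    using that by (metis inv_closed inv_solve_left inv_solve_right')
  show ?thesis unfolding blk_smash2[OF assms(4,5)]
    using assms by (subst sum_pair_delta[of "inv a \<otimes> k" "inv b \<otimes> l"]) (auto simp: 1)
qed

lemma at_one_one: "at_one \<one>\<^bsub>smash2 G n D\<^esub> 1"
  unfolding at_one_def by (simp add: smash2_def blk_tens row_one shift_def)

lemma at_one_mult: "at_one X x \<Longrightarrow> at_one Y y \<Longrightarrow> at_one (X \<otimes>\<^bsub>smash2 G n D\<^esub> Y) (x * y)"
  unfolding at_one_def[of "X \<otimes>\<^bsub>smash2 G n D\<^esub> Y"] by (simp add: blk_mult_at_one) (simp add: at_oneD)

lemma at_one_power: "at_one X x \<Longrightarrow> at_one (X [^]\<^bsub>smash2 G n D\<^esub> (m::nat)) (x ^ m)"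
proof (induction m)
  case 0
  then show ?case by (simp add: at_one_one)
next
  case (Suc m)
  then show ?case using at_one_mult[of "X [^]\<^bsub>smash2 G n D\<^esub> m" "x ^ m" X x]
    by (simp add: nat_pow_def power_commutes)
qed

lemma smash2_one_closed: "\<one>\<^bsub>smash2 G n D\<^esub> \<in> carrier (smash2 G n D)"
proof -
  have "\<one>\<^bsub>smash G n D\<^esub> \<in> supp_space (idx G n)"
    using bvec_in_supp_space[of "(\<one>, {})" "idx G n"] by (simp add: smash_def idx_def)
  then show ?thesis using tens_in_supp_space by (auto simp: smash2_def)
qed

lemma smash2_power_closed: "X [^]\<^bsub>smash2 G n D\<^esub> (m::nat) \<in> carrier (smash2 G n D)"
  by (cases m) (simp_all add: smash2_one_closed smash2_mult_closed nat_pow_def)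

lemma smash2_eqI:
  assumes "X \<in> carrier (smash2 G n D)" "Y \<in> carrier (smash2 G n D)"
    "\<And>k l. k \<in> carrier G \<Longrightarrow> l \<in> carrier G \<Longrightarrow> blk n X k l = blk n Y k l"
  shows "X = Y"
proof
  fix p
  show "X p = Y p"
  proof (cases "p \<in> idx G n \<times> idx G n")
    case True
    then obtain k S l T where "p = ((k, S), (l, T))" "k \<in> carrier G" "l \<in> carrier G" "S \<subseteq> {..<n}" "T \<subseteq> {..<n}"
      unfolding idx_def by auto
    then show ?thesis using blk_eqD[OF assms(3)] by simp
  next
    case False
    then show ?thesis using assms(1,2) unfolding carrier_smash2 by (metis supp_spaceD)
  qed
qed

lemma at_one_tensor_of: "at_one (tensor_of G n B) (quad n B)"
  unfolding at_one_def
proof (intro ballI)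
  fix k l
  have emb: "row n (emb_vec G i) k = (if k = \<one> then gen i else 0)" if "i < n" for i k
    using that row_bvec[of "{i}" n \<one> k] by (simp add: emb_vec_def vprod_def)
  have "blk n (tensor_of G n B) k l =
      (\<Sum>i<n. \<Sum>j<n. const (B i j) * (row n (emb_vec G i) k * shift n (row n (emb_vec G j) l)))"
    by (simp add: tensor_of_def blk_sum blk_cmult blk_tens)
  also have "\<dots> = (if k = \<one> \<and> l = \<one> then quad n B else 0)"
    by (cases "k = \<one>"; cases "l = \<one>") (simp_all add: emb quad_def shift_def)
  finally show "blk n (tensor_of G n B) k l = (if k = \<one> \<and> l = \<one> then quad n B else 0)" .
qed

text \<open>The \<open>m\<close>-th power of B has degree \<open>2 * m\<close> in
  \<open>2 * n\<close> generators, so the series stops at \<open>m = n\<close>.\<close>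

lemma twist_eq_sum:
  "twist G n D B = (\<lambda>p. \<Sum>m\<le>n. 1 / fact m * (tensor_of G n B [^]\<^bsub>smash2 G n D\<^esub> m) p)"
proof
  fix p
  let ?T = "\<lambda>m. tensor_of G n B [^]\<^bsub>smash2 G n D\<^esub> (m::nat)"
  have "?T m p = 0" if "m \<notin> {..n}" for m
  proof -
    have "homog (2 * m) (quad n B ^ m)" by (rule homog_power[OF homog_quad])
    then have "quad n B ^ m = 0"
      using homog_below_0[OF _ below_power[OF below_quad]] that by fastforce
    then have 0: "at_one (?T m) 0" using at_one_power[OF at_one_tensor_of, of B m] by simp
    have "?T m = (\<lambda>_. 0)"
      by (rule smash2_eqI[OF smash2_power_closed])
        (simp_all add: carrier_smash2 supp_space_def blk_0 at_oneD[OF 0])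
    then show ?thesis by simp
  qed
  then have "twist G n D B p = (\<Sum>m\<in>{..n}. ?T m p / fact m)"
    unfolding twist_def by (intro suminf_finite) auto
  then show "twist G n D B p = (\<Sum>m\<le>n. 1 / fact m * ?T m p)" by simp
qed

lemma twist_closed: "twist G n D B \<in> carrier (smash2 G n D)"
proof -
  have "(tensor_of G n B [^]\<^bsub>smash2 G n D\<^esub> m) p = 0" if "p \<notin> idx G n \<times> idx G n" for m :: nat and p
    using smash2_power_closed[of "tensor_of G n B" m] that unfolding carrier_smash2 by (rule supp_spaceD)
  then show ?thesis unfolding twist_eq_sum carrier_smash2 by (simp add: supp_space_def del: split_paired_All)
qed

lemma at_one_twist: "at_one (twist G n D B) (texp n (quad n B))"
  unfolding at_one_def twist_eq_sum blk_sum blk_cmult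
  by (auto simp: at_oneD[OF at_one_power[OF at_one_tensor_of]] texp_def intro!: sum.neutral)

text \<open>The inverse is a definite description, so uniqueness has to be shown. Right
  multiplication by the twist multiplies every block by the same invertible element exp(B), hence a
  left inverse is determined block by block.\<close>

lemma inv_twist: "inv\<^bsub>smash2 G n D\<^esub> (twist G n D B) = twist G n D (\<lambda>i j. - B i j)"
proof -
  let ?J = "twist G n D B" and ?K = "twist G n D (\<lambda>i j. - B i j)"
  let ?j = "texp n (quad n B)" and ?k = "texp n (quad n (\<lambda>i j. - B i j))"
  have neg: "quad n (\<lambda>i j. - B i j) = - quad n B"
    using quad_diff[of n "\<lambda>_ _. 0" B] by (simp add: quad_def)
  have jk: "?j * ?k = 1"
    using texp_add[of "quad n B" "- quad n B" n] homog_quad below_quad neg by (metis add.right_inverse texp_0)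
  have kj: "?k * ?j = 1"
    using homog_even_texp_central[OF homog_quad, of n n B ?k] jk by simp
  show ?thesis unfolding m_inv_def
  proof (rule the_equality)
    show "?K \<in> carrier (smash2 G n D) \<and> ?J \<otimes>\<^bsub>smash2 G n D\<^esub> ?K = \<one>\<^bsub>smash2 G n D\<^esub> \<and>
        ?K \<otimes>\<^bsub>smash2 G n D\<^esub> ?J = \<one>\<^bsub>smash2 G n D\<^esub>"
      using at_one_mult[OF at_one_twist at_one_twist, of B "\<lambda>i j. - B i j"]
        at_one_mult[OF at_one_twist at_one_twist, of "\<lambda>i j. - B i j" B] at_one_one jk kj
      by (auto simp: twist_closed at_oneD intro!: smash2_eqI smash2_mult_closed smash2_one_closed)
  next
    fix Y assume Y: "Y \<in> carrier (smash2 G n D) \<and> ?J \<otimes>\<^bsub>smash2 G n D\<^esub> Y = \<one>\<^bsub>smash2 G n D\<^esub> \<and>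
        Y \<otimes>\<^bsub>smash2 G n D\<^esub> ?J = \<one>\<^bsub>smash2 G n D\<^esub>"
    have "blk n Y k l = blk n ?K k l" if kl: "k \<in> carrier G" "l \<in> carrier G" for k l
    proof -
      have "blk n Y k l * ?j = (if k = \<one> \<and> l = \<one> then 1 else 0)"
        using blk_mult_at_one[OF at_one_twist kl, of Y B] Y at_oneD[OF at_one_one kl] by simp
      then have "blk n Y k l * ?j * ?k = (if k = \<one> \<and> l = \<one> then ?k else 0)" by simp
      then show ?thesis using jk at_oneD[OF at_one_twist kl] by (simp add: mult.assoc)
    qed
    then show "Y = ?K" using Y by (intro smash2_eqI twist_closed) auto
  qed
qed

text \<open>Group elements are group-like, so only the blocks \<open>(k, k)\<close> occur; vectors
  are primitive, so on \<Lambda>V the coproduct is the substitution \<open>diag n\<close>.\<close>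

lemma blk_comult:
  assumes "k \<in> carrier G" "l \<in> carrier G"
  shows "blk n (comult G n D x) k l = (if k = l then extend (diag n) (row n x k) else 0)"
proof -
  let ?f = "\<lambda>i X. (tens (emb_vec G i) \<one>\<^bsub>smash G n D\<^esub> \<oplus>\<^bsub>smash2 G n D\<^esub>
                    tens \<one>\<^bsub>smash G n D\<^esub> (emb_vec G i)) \<otimes>\<^bsub>smash2 G n D\<^esub> X"
  have emb: "row n (emb_vec G i) k = (if k = \<one> then gen i else 0)" if "i < n" for i k
    using that row_bvec[of "{i}" n \<one> k] by (simp add: emb_vec_def vprod_def)
  have "at_one (tens (emb_vec G i) \<one>\<^bsub>smash G n D\<^esub> \<oplus>\<^bsub>smash2 G n D\<^esub>
                    tens \<one>\<^bsub>smash G n D\<^esub> (emb_vec G i)) (diag n i)" if "i < n" for i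
    using that by (simp add: at_one_def smash2_def blk_add blk_tens row_one emb diag_def shift_def)
  then have "at_one (foldr ?f xs \<one>\<^bsub>smash2 G n D\<^esub>) (prod_list (map (diag n) xs))" if "set xs \<subseteq> {..<n}" for xs
    using that by (induction xs) (auto simp: at_one_one at_one_mult)
  then have fold: "at_one (foldr ?f (sorted_list_of_set S) \<one>\<^bsub>smash2 G n D\<^esub>) (vprod (diag n) S)"
    if "S \<subseteq> {..<n}" for S
    using that by (simp add: vprod_def finite_subset_lessThan)
  have basis: "blk n (tens (emb_grp g) (emb_grp g) \<otimes>\<^bsub>smash2 G n D\<^esub>
      foldr ?f (sorted_list_of_set S) \<one>\<^bsub>smash2 G n D\<^esub>) k l =
      (if k = g then if k = l then vprod (diag n) S else 0 else 0)" if "S \<in> Pow {..<n}" for g S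
    using that row_bvec[of "{}" n g]
    by (simp add: blk_mult_at_one[OF fold assms] blk_tens emb_grp_def shift_def)
  have "blk n (comult G n D x) k l = (\<Sum>g\<in>carrier G. \<Sum>S\<in>Pow {..<n}.
      const (x (g, S)) * (if k = g then if k = l then vprod (diag n) S else 0 else 0))"
    unfolding comult_def case_prod_beta blk_sum blk_cmult sum_idx fst_conv snd_conv
    by (intro sum.cong refl) (simp only: basis)
  also have "\<dots> = (\<Sum>g\<in>carrier G. if k = g then \<Sum>S\<in>Pow {..<n}.
      const (x (k, S)) * (if k = l then vprod (diag n) S else 0) else 0)"
    by (intro sum.cong refl) auto
  also have "\<dots> = (\<Sum>S\<in>Pow {..<n}. const (x (k, S)) * (if k = l then vprod (diag n) S else 0))"
    using assms finite_carrier by (simp add: sum.delta')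
  finally show ?thesis by (simp add: row_def extend_trunc)
qed

text \<open>What remains of the twist at \<open>k\<close>: J contributes B, and its inverse, moved
  to the right past k \<otimes> k, contributes minus the transform of B by the inverse of
  \<open>k\<close>.\<close>

definition defect :: "(nat \<Rightarrow> nat \<Rightarrow> complex) \<Rightarrow> 'g \<Rightarrow> nat \<Rightarrow> nat \<Rightarrow> complex" where
  "defect B k = (\<lambda>i j. B i j - congr n (D (inv k)) B i j)"

lemma blk_comult_J:
  assumes kl: "k \<in> carrier G" "l \<in> carrier G"
  shows "blk n (comult_J G n D B x) k l =
    (if k = l then texp n (quad n (defect B k)) * extend (diag n) (row n x k) else 0)"
proof -
  let ?j = "texp n (quad n B)" and ?k = "texp n (quad n (\<lambda>i j. - B i j))"
  have neg: "quad n (\<lambda>i j. - C i j) = - quad n C" for C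
    using quad_diff[of n "\<lambda>_ _. 0" C] by (simp add: quad_def)
  have "\<Lambda> k k ?k = texp n (quad n (\<lambda>i j. - congr n (D (inv k)) B i j))"
    by (simp add: extend_texp[OF anticommuting_lin2] extend_minus extend_quad neg)
  moreover have "quad n (defect B k) = quad n B + quad n (\<lambda>i j. - congr n (D (inv k)) B i j)"
    by (simp add: defect_def quad_diff neg)
  ultimately have d: "?j * \<Lambda> k k ?k = texp n (quad n (defect B k))"
    by (simp add: texp_add homog_quad below_quad)
  have "blk n (comult_J G n D B x) k l = \<Lambda> k l ?k * blk n (comult G n D x) k l * ?j"
    unfolding comult_J_def inv_twist
    by (simp add: blk_mult_at_one[OF at_one_twist kl] blk_at_one_mult[OF at_one_twist kl])
  \<comment> \<open>The exponential of an element of degree 2 is central, so the right factor J can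
    be brought next to the transformed inverse.\<close>
  also have "\<dots> = ?j * (\<Lambda> k l ?k * blk n (comult G n D x) k l)"
    by (rule homog_even_texp_central[OF homog_quad, symmetric])
  finally show ?thesis unfolding blk_comult[OF kl] d[symmetric] by (simp add: mult.assoc)
qed

end

subsection \<open>The coproduct of A\<close>

lemma vprod_uminus: "finite S \<Longrightarrow> vprod (\<lambda>i. - v i) S = const ((-1) ^ card S) * vprod v S"
proof -
  assume "finite S"
  have "prod_list (map (\<lambda>i. - v i) xs) = const ((-1) ^ length xs) * prod_list (map v xs)" for xs
  proof (induction xs)
    case (Cons i xs)
    then show ?case
      by (simp add: const_minus mult_const_left_commute[of "v i"])
  qed simp
  then show ?thesis by (simp add: vprod_def)
qed

text \<open>The sign automorphism of \<Lambda>V as a substitution of generators;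
  \<open>parity2\<close> is its analogue for the second copy of V. Both are scalar on each copy of
  V, so the parity projections built from them commute with the maps induced by matrices.\<close>

definition parity :: "nat \<Rightarrow> ext" where
  "parity j = - gen j"

definition parity2 :: "nat \<Rightarrow> nat \<Rightarrow> ext" where
  "parity2 n j = (if j < n then gen j else - gen j)"

lemma anticommuting_parity: "anticommuting parity"
  unfolding parity_def by (intro anticommutingI homog_minus homog_gen)

lemma anticommuting_parity2: "anticommuting (parity2 n)"
proof (rule anticommutingI)
  show "homog 1 (parity2 n j)" for j
    unfolding parity2_def using homog_gen[of j] homog_minus[OF homog_gen[of j]] by (cases "j < n") simp_all
qed

lemma extend_parity_lin: "extend parity (extend (lin n M) x) = extend (lin n M) (extend parity x)"
  by (simp add: extend_extend anticommuting_parity anticommuting_lin)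
    (rule arg_cong[where f = "\<lambda>v. extend v x"], simp add: fun_eq_iff lin_def parity_def extend_sum extend_const_mult
      extend_minus sum_negf)

lemma extend_parity2_lin2:
  "extend (parity2 n) (extend (lin2 n M N) x) = extend (lin2 n M N) (extend (parity2 n) x)"
proof -
  have "extend (parity2 n) (lin2 n M N j) = extend (lin2 n M N) (parity2 n j)" for j
  proof (cases "j < n")
    case True
    have "extend (parity2 n) (lin n M j) = lin n M j"
      by (rule extend_id_below[OF below_lin]) (simp add: parity2_def)
    then show ?thesis using True by (simp add: lin2_def parity2_def)
  next
    case False
    have "extend (parity2 n) (shift n (lin n N i)) = - shift n (lin n N i)" for i
      by (simp add: lin_def shift_def extend_sum extend_const_mult parity2_def sum_negf)
    then show ?thesis using False by (simp add: lin2_def parity2_def extend_minus)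
  qed
  then show ?thesis by (simp add: extend_extend anticommuting_lin2 anticommuting_parity2)
qed

lemma extend_parity_vprod:
  "S \<subseteq> {..<n} \<Longrightarrow> extend parity (vprod gen S) = const ((-1) ^ card S) * vprod gen S"
  using vprod_uminus[of S gen] by (simp add: extend_vprod_gen finite_subset_lessThan parity_def[abs_def])

lemma const_half_mult:
  "const (1 / 2 * (c + a * (b * c))) * z = const (1 / 2) * (const c * z + const a * (const c * (const b * z)))"
  by (rule ext_eqI) (simp add: algebra_simps)

lemma extend_parity2_vprod:
  assumes "S \<subseteq> {..<n}" "T \<subseteq> {..<n}"
  shows "extend (parity2 n) (vprod gen S * shift n (vprod gen T)) =
    const ((-1) ^ card T) * (vprod gen S * shift n (vprod gen T))"
proof -
  have "extend (parity2 n) (vprod gen S) = vprod gen S"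
    using assms(1) by (intro extend_id_below[OF below_vprod_gen]) (auto simp: parity2_def)
  moreover have "extend (parity2 n) (shift n (vprod gen T)) = const ((-1) ^ card T) * shift n (vprod gen T)"
    using assms(2) by (simp add: shift_def extend_vprod_gen finite_subset_lessThan extend_vprod
        anticommuting_parity2 parity2_def vprod_uminus)
  ultimately show ?thesis
    by (simp add: extend_mult anticommuting_parity2 mult_const_left_commute[of "vprod gen S"])
qed

lemma half_sign:
  assumes "q \<in> {0, 1::nat}"
  shows "(if m mod 2 = q then x else 0) = (1/2) * (x + (-1) ^ q * ((-1) ^ m * (x::complex)))"
proof (cases "even m")
  case True
  then show ?thesis using assms by auto
next
  case False
  then show ?thesis using assms by (auto simp: odd_iff_mod_2_eq_one)
qed

text \<open>The projection (1 + (-1)^q s) / 2 for the map s = \<open>extend v\<close>: with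
  \<open>parity\<close> it selects the parity of an element, with \<open>parity2\<close> the parity
  of the second tensor factor.\<close>

definition part :: "(nat \<Rightarrow> ext) \<Rightarrow> nat \<Rightarrow> ext \<Rightarrow> ext" where
  "part v q x = const (1/2) * (x + const ((-1) ^ q) * extend v x)"

lemma row_hom_part:
  assumes "q \<in> {0, 1}"
  shows "row n (hom_part q x) k = part parity q (row n x k)"
proof -
  have "const (if card S mod 2 = q then c else 0) * vprod gen S =
      const (1/2) * (const c * vprod gen S + const ((-1) ^ q) * (const c * extend parity (vprod gen S)))"
    if "S \<in> Pow {..<n}" for S c
    using that unfolding half_sign[OF assms] const_half_mult by (simp add: extend_parity_vprod)
  then show ?thesis
    by (simp add: row_def trunc_def hom_part_def part_def extend_sum extend_const_mult
        sum_distrib_left sum.distrib distrib_left)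
qed

lemma blk_second_part:
  assumes "q \<in> {0, 1}"
  shows "blk n (second_part q X) k l = part (parity2 n) q (blk n X k l)"
proof -
  have "const (if card T mod 2 = q then c else 0) * (vprod gen S * shift n (vprod gen T)) =
      const (1/2) * (const c * (vprod gen S * shift n (vprod gen T)) +
        const ((-1) ^ q) * (const c * extend (parity2 n) (vprod gen S * shift n (vprod gen T))))"
    if "S \<in> Pow {..<n}" "T \<in> Pow {..<n}" for S T c
    using that unfolding half_sign[OF assms] const_half_mult by (simp add: extend_parity2_vprod)
  then show ?thesis
    by (simp add: blk_def second_part_def part_def extend_sum extend_const_mult
        sum_distrib_left sum.distrib distrib_left)
qed

lemma part_parity_lin: "extend (lin n M) (part parity q x) = part parity q (extend (lin n M) x)"
  by (simp add: part_def extend_const_mult extend_add extend_parity_lin)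

lemma part_parity2_lin2: "extend (lin2 n M N) (part (parity2 n) q x) = part (parity2 n) q (extend (lin2 n M N) x)"
  by (simp add: part_def extend_const_mult extend_add extend_parity2_lin2)

lemma part_0 [simp]: "part v q 0 = 0"
  by (simp add: part_def)

context smash_product
begin

text \<open>The block at \<open>(k, k)\<close> of the twisted coproduct of the parity
  \<open>q\<close> part of an element whose component at \<open>k\<close> is \<open>x\<close>. Both
  parities are covered.\<close>

definition odd_comult :: "(nat \<Rightarrow> nat \<Rightarrow> complex) \<Rightarrow> nat \<Rightarrow> 'g \<Rightarrow> ext \<Rightarrow> ext" where
  "odd_comult B q k x = texp n (quad n (defect B k)) * extend (diag n) (part parity q x)"

text \<open>Multiplication by u \<otimes> 1 moves the odd terms from the block \<open>(l, l)\<close>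
  to the block with labels ul and l. This is why the coalgebra decomposes along the cosets {g, ug}
  and no further.\<close>

lemma blk_comult_A:
  assumes "u \<in> carrier G" "k \<in> carrier G" "l \<in> carrier G"
  shows "blk n (comult_A G n D u B x) k l = (\<Sum>q\<in>{0, 1}.
    (if k = l then part (parity2 n) 0 (odd_comult B q k (row n x k)) else 0) -
    const ((-1) ^ q) * (if inv u \<otimes> k = l then part (parity2 n) 1 (odd_comult B q l (row n x l)) else 0))"
proof -
  have J: "blk n (comult_J G n D B (hom_part q x)) k l =
      (if k = l then odd_comult B q l (row n x l) else 0)"
    if "q \<in> {0, 1}" "k \<in> carrier G" "l \<in> carrier G" for q k l
    using that by (simp add: blk_comult_J row_hom_part odd_comult_def)
  have u: "blk n (tens (emb_grp u) \<one>\<^bsub>smash G n D\<^esub>) k l = (if k = u \<and> l = \<one> then 1 else 0)" for k l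
    using row_bvec[of "{}" n u k] by (simp add: blk_tens row_one emb_grp_def shift_def)
  show ?thesis
    unfolding comult_A_def blk_sum blk_diff blk_cmult
    using assms by (intro sum.cong refl) (auto simp: blk_group_mult[OF u] blk_second_part J)
qed

section \<open>The coalgebra map defined by a family of matrices\<close>

definition transport :: "('g \<Rightarrow> nat \<Rightarrow> nat \<Rightarrow> complex) \<Rightarrow> ('g idx \<Rightarrow> complex) \<Rightarrow> 'g idx \<Rightarrow> complex" where
  "transport P x = (\<lambda>(k, S). if k \<in> carrier G then coeff (extend (lin n (P k)) (row n x k)) S else 0)"

lemma below_lin_extend: "below n (extend (lin n M) x)"
  by (rule below_extend) (rule below_lin)

lemma row_transport: "k \<in> carrier G \<Longrightarrow> row n (transport P x) k = extend (lin n (P k)) (row n x k)"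
  by (simp add: row_def transport_def trunc_coeff[OF below_lin_extend])

lemma transport_in_supp_space: "transport P x \<in> supp_space (idx G n)"
  using below_lin_extend[of "P _" "row n x _"]
  by (auto simp: supp_space_def transport_def idx_def below_def)

text \<open>The twisted coproduct is natural only for one matrix acting on both tensor factors. On
  the blocks \<open>(k, k)\<close> this is automatic; on the blocks with labels ul and l it is the
  condition \<open>Pu\<close>. The exponential factor is handled by the condition on
  \<open>defect\<close>.\<close>

lemma blk_comult_A_transport:
  assumes u: "u \<in> carrier G" and kl: "k \<in> carrier G" "l \<in> carrier G"
    and Pu: "\<And>g. g \<in> carrier G \<Longrightarrow> P (u \<otimes> g) = P g"
    and P: "\<And>g i j. g \<in> carrier G \<Longrightarrow> i < n \<Longrightarrow> j < n \<Longrightarrow> congr n (P g) (defect B g) i j = defect B' g i j"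
  shows "extend (lin2 n (P k) (P l)) (blk n (comult_A G n D u B x) k l) =
    blk n (comult_A G n D u B' (transport P x)) k l"
proof -
  have Z: "extend (lin2 n (P g) (P g)) (odd_comult B q g (row n x g)) =
      odd_comult B' q g (row n (transport P x) g)" if "g \<in> carrier G" for q g
  proof -
    have "quad n (congr n (P g) (defect B g)) = quad n (defect B' g)"
      by (rule quad_cong) (rule P[OF that])
    then show ?thesis
      by (simp add: odd_comult_def extend_mult[OF anticommuting_lin2] extend_texp[OF anticommuting_lin2]
          extend_quad extend_diag row_transport[OF that] part_parity_lin)
  qed
  have eq: "P k = P l" if "inv u \<otimes> k = l"
    using Pu[of l] u kl that by (metis inv_solve_left)
  show ?thesis
    unfolding blk_comult_A[OF u kl] extend_sum extend_diff extend_const_mult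
    by (intro sum.cong refl) (auto simp: part_parity2_lin2 Z kl eq)
qed

lemma transport_inverse:
  assumes "x \<in> supp_space (idx G n)"
    and PQ: "\<And>g i j. g \<in> carrier G \<Longrightarrow> i < n \<Longrightarrow> j < n \<Longrightarrow>
      (\<Sum>a<n. Q g i a * P g a j) = (if i = j then 1 else 0)"
  shows "transport Q (transport P x) = x"
proof (rule ext, clarify)
  fix k S
  show "transport Q (transport P x) (k, S) = x (k, S)"
  proof (cases "k \<in> carrier G")
    case k: True
    have "extend (lin n (Q k)) (lin n (P k) j) = gen j" if "j < n" for j
    proof -
      have "extend (lin n (Q k)) (lin n (P k) j) = (\<Sum>a<n. \<Sum>i<n. const (Q k i a * P k a j) * gen i)"
        using that by (simp add: lin_def extend_sum extend_const_mult sum_distrib_left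
            const_mult[symmetric] mult.assoc[symmetric] mult.commute)
      also have "\<dots> = (\<Sum>i<n. const (\<Sum>a<n. Q k i a * P k a j) * gen i)"
        by (subst sum.swap) (simp add: const_sum sum_distrib_right)
      also have "\<dots> = (\<Sum>i<n. if i = j then gen j else 0)"
        using PQ[OF k] that by (intro sum.cong refl) auto
      finally show ?thesis using that by simp
    qed
    then have "extend (lin n (Q k)) (extend (lin n (P k)) (row n x k)) = row n x k"
      unfolding extend_extend[OF anticommuting_lin] by (intro extend_id_below[OF below_row])
    then have "transport Q (transport P x) (k, S) = coeff (row n x k) S"
      using k by (simp add: transport_def[of Q] row_transport)
    then show ?thesis using assms(1) k
      by (auto simp: row_def coeff_trunc supp_space_def idx_def)
  qed (use assms(1) in \<open>auto simp: transport_def supp_space_def idx_def\<close>)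
qed

end

subsection \<open>Isomorphisms of the dual algebras\<close>

lemma row_add: "row n (\<lambda>a. x a + y a) k = row n x k + row n y k"
  by (simp add: row_def trunc_add)

lemma row_cmult: "row n (\<lambda>a. c * x a) k = const c * row n x k"
  by (simp add: row_def trunc_cmult)

text \<open>Substituting elements of degree 1 turns positive degrees into positive degrees, so the
  scalar term survives unchanged. This makes \<open>transport\<close> compatible with the
  counit.\<close>

lemma coeff_empty_extend:
  assumes "\<And>i. homog 1 (v i)"
  shows "coeff (extend v x) {} = coeff x {}"
proof -
  let ?A = "insert {} {S. coeff x S \<noteq> 0}"
  have v: "coeff (vprod v S) {} = (if S = {} then 1 else 0)" if "finite S" for S
    using homog_vprod[of v S] assms that by (auto simp: homog_def coeff_1 bvec_def)
  have "coeff (extend v x) {} = (\<Sum>S\<in>?A. coeff x S * coeff (vprod v S) {})"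
    using finite_support[of x] by (subst extend_superset[of ?A]) (auto simp: coeff_sum)
  also have "\<dots> = (\<Sum>S\<in>?A. if S = {} then coeff x {} else 0)"
  proof (intro sum.cong refl)
    fix S assume "S \<in> ?A"
    then have "finite S" using coeff_infinite[of S x] by auto
    then show "coeff x S * coeff (vprod v S) {} = (if S = {} then coeff x {} else 0)" by (simp add: v)
  qed
  also have "\<dots> = coeff x {}" using finite_support[of x] by simp
  finally show ?thesis .
qed

lemma alg_iso_trans:
  assumes "alg_iso R S" "alg_iso S T"
  shows "alg_iso R T"
proof -
  obtain f g where f: "f \<in> ring_iso R S" "\<forall>c. \<forall>x\<in>carrier R. f (c \<odot>\<^bsub>R\<^esub> x) = c \<odot>\<^bsub>S\<^esub> f x"
    and g: "g \<in> ring_iso S T" "\<forall>c. \<forall>x\<in>carrier S. g (c \<odot>\<^bsub>S\<^esub> x) = c \<odot>\<^bsub>T\<^esub> g x"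
    using assms unfolding alg_iso_def by blast
  have "g \<circ> f \<in> ring_iso R T" using f(1) g(1) by (rule ring_iso_set_trans)
  moreover have "\<forall>c. \<forall>x\<in>carrier R. (g \<circ> f) (c \<odot>\<^bsub>R\<^esub> x) = c \<odot>\<^bsub>T\<^esub> (g \<circ> f) x"
    using f g ring_iso_memE(1)[OF f(1)] by simp
  ultimately show ?thesis unfolding alg_iso_def by blast
qed

context smash_product
begin

section \<open>Pulling functionals back along the transport map\<close>

lemma finite_idx: "finite (idx G n)"
  by (simp add: idx_def finite_carrier)

lemma transport_add: "transport P (\<lambda>a. x a + y a) = (\<lambda>a. transport P x a + transport P y a)"
  by (auto simp: transport_def row_add extend_add)

lemma transport_cmult: "transport P (\<lambda>a. c * x a) = (\<lambda>a. c * transport P x a)"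
  by (auto simp: transport_def row_cmult extend_const_mult)

lemma counit_transport: "counit G (transport P x) = counit G x"
  unfolding counit_def
proof (intro sum.cong refl)
  fix g assume "g \<in> carrier G"
  then show "transport P x (g, {}) = x (g, {})"
    by (simp add: transport_def coeff_empty_extend[OF homog_lin] coeff_row)
qed

lemma dual_memD:
  assumes "f \<in> carrier (dual_A G n D u B)"
  shows "f \<in> extensional (supp_space (idx G n))"
    and "\<And>x y. x \<in> supp_space (idx G n) \<Longrightarrow> y \<in> supp_space (idx G n) \<Longrightarrow> f (\<lambda>a. x a + y a) = f x + f y"
    and "\<And>c x. x \<in> supp_space (idx G n) \<Longrightarrow> f (\<lambda>a. c * x a) = c * f x"
  using assms by (auto simp: dual_A_def Let_def)

lemma dual_expand:
  assumes f: "f \<in> carrier (dual_A G n D u B)" and x: "x \<in> supp_space (idx G n)"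
  shows "f x = (\<Sum>a\<in>idx G n. x a * f (bvec a))"
proof -
  \<comment> \<open>Linearity of \<open>f\<close> is available only inside
    \<open>supp_space\<close>, so membership of the partial sums is carried along in the
    induction.\<close>
  have A: "(\<lambda>b. \<Sum>a\<in>I. x a * bvec a b) \<in> supp_space (idx G n) \<and>
      f (\<lambda>b. \<Sum>a\<in>I. x a * bvec a b) = (\<Sum>a\<in>I. x a * f (bvec a))"
    if "finite I" "I \<subseteq> idx G n" for I
    using that
  proof (induction I rule: finite_induct)
    case empty
    then show ?case using dual_memD(3)[OF f, of "\<lambda>_. 0" 0] by (simp add: supp_space_def)
  next
    case (insert a I)
    have a: "bvec a \<in> supp_space (idx G n)" using insert by (intro bvec_in_supp_space) auto
    then have "(\<lambda>b. x a * bvec a b) \<in> supp_space (idx G n)" by (simp add: supp_space_def)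
    then show ?case
      using insert dual_memD(2)[OF f, of "\<lambda>b. x a * bvec a b"] dual_memD(3)[OF f a]
      by (simp add: supp_space_def)
  qed
  have "x = (\<lambda>b. \<Sum>a\<in>idx G n. x a * bvec a b)"
  proof
    fix b
    have "(\<Sum>a\<in>idx G n. x a * bvec a b) = (\<Sum>a\<in>idx G n. if a = b then x b else 0)"
      by (intro sum.cong) (auto simp: bvec_def)
    then show "x b = (\<Sum>a\<in>idx G n. x a * bvec a b)" using supp_spaceD[OF x, of b] finite_idx by auto
  qed
  then show ?thesis using A[OF finite_idx] by simp
qed

text \<open>Pulling back both functionals amounts to evaluating them on the image of
  \<open>X\<close> under the tensor square of \<open>transport P\<close>. This image is
  \<open>?Y\<close>, and its blocks are those of \<open>X'\<close>.\<close>

lemma tens_functional_transport: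
  assumes f: "f \<in> carrier (dual_A G n D u B)" and g: "g \<in> carrier (dual_A G n D u B)"
    and blk: "\<And>k l. k \<in> carrier G \<Longrightarrow> l \<in> carrier G \<Longrightarrow>
      extend (lin2 n (P k) (P l)) (blk n X k l) = blk n X' k l"
  shows "tens_functional G n (\<lambda>x. f (transport P x)) (\<lambda>x. g (transport P x)) X = tens_functional G n f g X'"
proof -
  let ?I = "idx G n"
  let ?t = "\<lambda>a. transport P (bvec a)"
  let ?Y = "\<lambda>p. \<Sum>(a, b)\<in>?I \<times> ?I. X (a, b) * tens (?t a) (?t b) p"
  have blkY: "blk n ?Y k l = blk n X' k l" if kl: "k \<in> carrier G" "l \<in> carrier G" for k l
  proof -
    have "blk n ?Y k l = (\<Sum>g\<in>carrier G. \<Sum>h\<in>carrier G. \<Sum>S\<in>Pow {..<n}. \<Sum>T\<in>Pow {..<n}.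
        const (X ((g, S), (h, T))) * (row n (?t (g, S)) k * shift n (row n (?t (h, T)) l)))"
      unfolding blk_sum case_prod_beta blk_cmult blk_tens sum_idx2 by simp
    also have "\<dots> = (\<Sum>S\<in>Pow {..<n}. \<Sum>T\<in>Pow {..<n}.
        const (X ((k, S), (l, T))) * (row n (?t (k, S)) k * shift n (row n (?t (l, T)) l)))"
      using kl by (subst sum_pair_delta[of k l])
        (auto simp: row_transport row_bvec shift_def intro!: sum.neutral)
    also have "\<dots> = extend (lin2 n (P k) (P l)) (blk n X k l)"
      unfolding extend_blk using kl by (intro sum.cong refl) (simp add: row_transport row_bvec)
    finally show ?thesis using blk[OF kl] by simp
  qed
  \<comment> \<open>Agreement on these indices is enough, since \<open>tens_functional\<close> reads
    no other coefficients.\<close>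
  have Y: "?Y p = X' p" if "p \<in> ?I \<times> ?I" for p
  proof -
    obtain k S l T where p: "p = ((k, S), (l, T))" "k \<in> carrier G" "l \<in> carrier G" "S \<subseteq> {..<n}" "T \<subseteq> {..<n}"
      using \<open>p \<in> ?I \<times> ?I\<close> unfolding idx_def by auto
    show ?thesis using blk_eqD[OF blkY[OF p(2,3)] p(4,5)] unfolding p(1) .
  qed
  have ft: "f (?t a) = (\<Sum>a'\<in>?I. ?t a a' * f (bvec a'))"
    and gt: "g (?t a) = (\<Sum>a'\<in>?I. ?t a a' * g (bvec a'))" for a
    using dual_expand[OF f transport_in_supp_space] dual_expand[OF g transport_in_supp_space] by blast+
  have "tens_functional G n (\<lambda>x. f (transport P x)) (\<lambda>x. g (transport P x)) X =
      (\<Sum>p\<in>?I \<times> ?I. \<Sum>q\<in>?I \<times> ?I. X p * tens (?t (fst p)) (?t (snd p)) q * (f (bvec (fst q)) * g (bvec (snd q))))"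
  proof -
    have "f (?t a) * g (?t b) =
        (\<Sum>q\<in>?I \<times> ?I. tens (?t a) (?t b) q * (f (bvec (fst q)) * g (bvec (snd q))))" for a b
      unfolding ft[of a] gt[of b] sum_product sum.cartesian_product
      by (intro sum.cong refl) (simp add: tens_def case_prod_beta)
    then show ?thesis
      unfolding tens_functional_def by (simp add: case_prod_beta sum_distrib_left mult.assoc)
  qed
  also have "\<dots> = (\<Sum>q\<in>?I \<times> ?I. \<Sum>p\<in>?I \<times> ?I. X p * tens (?t (fst p)) (?t (snd p)) q * (f (bvec (fst q)) * g (bvec (snd q))))"
    by (rule sum.swap)
  also have "\<dots> = (\<Sum>q\<in>?I \<times> ?I. ?Y q * (f (bvec (fst q)) * g (bvec (snd q))))"
    by (simp add: sum_distrib_right case_prod_beta)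
  also have "\<dots> = tens_functional G n f g X'"
    unfolding tens_functional_def by (intro sum.cong refl) (simp only: Y, simp add: case_prod_beta)
  finally show ?thesis .
qed

text \<open>Dualising reverses arrows: \<open>transport P\<close> maps the coalgebra for
  \<open>B\<close> to the one for \<open>B'\<close>, so the pullback goes from the dual for
  \<open>B'\<close> to the dual for \<open>B\<close>. Both duals have the same carrier, all
  functionals on one space.\<close>

lemma dual_A_iso:
  assumes u: "u \<in> carrier G"
    and Pu: "\<And>g. g \<in> carrier G \<Longrightarrow> P (u \<otimes> g) = P g"
    and P: "\<And>g i j. g \<in> carrier G \<Longrightarrow> i < n \<Longrightarrow> j < n \<Longrightarrow> congr n (P g) (defect B g) i j = defect B' g i j"
    and PQ: "\<And>g i j. g \<in> carrier G \<Longrightarrow> i < n \<Longrightarrow> j < n \<Longrightarrow>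
      (\<Sum>a<n. P g i a * Q g a j) = (if i = j then 1 else 0)"
    and QP: "\<And>g i j. g \<in> carrier G \<Longrightarrow> i < n \<Longrightarrow> j < n \<Longrightarrow>
      (\<Sum>a<n. Q g i a * P g a j) = (if i = j then 1 else 0)"
  shows "alg_iso (dual_A G n D u B') (dual_A G n D u B)"
proof -
  let ?A = "supp_space (idx G n)"
  let ?R = "dual_A G n D u B'" and ?S = "dual_A G n D u B"
  define h :: "('g \<Rightarrow> nat \<Rightarrow> nat \<Rightarrow> complex) \<Rightarrow> (('g idx \<Rightarrow> complex) \<Rightarrow> complex) \<Rightarrow> ('g idx \<Rightarrow> complex) \<Rightarrow> complex"
    where "h P f = (\<lambda>x\<in>?A. f (transport P x))" for P f
  have carrier_eq: "carrier ?R = carrier ?S" by (simp add: dual_A_def Let_def)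
  have add_closed: "(\<lambda>a. x a + y a) \<in> ?A" if "x \<in> ?A" "y \<in> ?A" for x y :: "'g idx \<Rightarrow> complex"
    using that by (simp add: supp_space_def)
  have cmult_closed: "(\<lambda>a. c * x a) \<in> ?A" if "x \<in> ?A" for c and x :: "'g idx \<Rightarrow> complex"
    using that by (simp add: supp_space_def)
  have closed: "h P f \<in> carrier ?S" if f: "f \<in> carrier ?S" for P f
    using dual_memD[OF f]
    by (simp add: dual_A_def Let_def h_def transport_add transport_cmult transport_in_supp_space add_closed cmult_closed)
  have cancel: "h P (h Q f) = f"
    if f: "f \<in> carrier ?S" and inv: "\<And>g i j. g \<in> carrier G \<Longrightarrow> i < n \<Longrightarrow> j < n \<Longrightarrow>
      (\<Sum>a<n. Q g i a * P g a j) = (if i = j then 1 else 0)" for P Q f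
  proof
    fix x
    show "h P (h Q f) x = f x"
    proof (cases "x \<in> ?A")
      case True
      have "transport Q (transport P x) = x" using True inv by (rule transport_inverse)
      then show ?thesis using True by (simp add: h_def transport_in_supp_space)
    next
      case False
      then show ?thesis using extensional_arb[OF dual_memD(1)[OF f]] by (simp add: h_def)
    qed
  qed
  have "h P \<in> ring_hom ?R ?S"
  proof (rule ring_hom_memI)
    show "h P f \<in> carrier ?S" if "f \<in> carrier ?R" for f using that closed carrier_eq by simp
    show "h P (f \<otimes>\<^bsub>?R\<^esub> g) = h P f \<otimes>\<^bsub>?S\<^esub> h P g" if fg: "f \<in> carrier ?R" "g \<in> carrier ?R" for f g
    proof
      fix x
      show "h P (f \<otimes>\<^bsub>?R\<^esub> g) x = (h P f \<otimes>\<^bsub>?S\<^esub> h P g) x"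
      proof (cases "x \<in> ?A")
        case True
        have "tens_functional G n (h P f) (h P g) X =
            tens_functional G n (\<lambda>x. f (transport P x)) (\<lambda>x. g (transport P x)) X" for X
          unfolding tens_functional_def
          by (intro sum.cong refl) (auto simp: h_def bvec_in_supp_space)
        moreover have "tens_functional G n (\<lambda>x. f (transport P x)) (\<lambda>x. g (transport P x)) (comult_A G n D u B x) =
            tens_functional G n f g (comult_A G n D u B' (transport P x))"
          using fg by (rule tens_functional_transport) (rule blk_comult_A_transport[OF u _ _ Pu P])
        ultimately show ?thesis using True
          by (simp add: h_def dual_A_def Let_def transport_in_supp_space)
      qed (simp add: h_def dual_A_def Let_def)
    qed
    show "h P (f \<oplus>\<^bsub>?R\<^esub> g) = h P f \<oplus>\<^bsub>?S\<^esub> h P g" for f g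
      by (rule ext) (simp add: h_def dual_A_def Let_def transport_in_supp_space)
    show "h P \<one>\<^bsub>?R\<^esub> = \<one>\<^bsub>?S\<^esub>"
      by (rule ext) (simp add: h_def dual_A_def Let_def transport_in_supp_space counit_transport)
  qed
  \<comment> \<open>The pullback along \<open>transport Q\<close> serves here as the inverse map on
    carriers.\<close>
  moreover have "bij_betw (h P) (carrier ?R) (carrier ?S)"
    unfolding carrier_eq
    by (rule bij_betw_byWitness[where f' = "h Q"]) (auto simp: closed cancel PQ QP)
  moreover have "h P (c \<odot>\<^bsub>?R\<^esub> f) = c \<odot>\<^bsub>?S\<^esub> h P f" for c f
    by (rule ext) (simp add: h_def dual_A_def Let_def transport_in_supp_space)
  ultimately show ?thesis unfolding alg_iso_def ring_iso_def by blast
qed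

end

subsection \<open>Symmetric matrices up to congruence\<close>

definition mat_mult :: "nat \<Rightarrow> (nat \<Rightarrow> nat \<Rightarrow> complex) \<Rightarrow> (nat \<Rightarrow> nat \<Rightarrow> complex) \<Rightarrow> nat \<Rightarrow> nat \<Rightarrow> complex" where
  "mat_mult n A B i j = (\<Sum>a<n. A i a * B a j)"

text \<open>Functions stand for n \<times> n matrices and are compared only at indices below
  \<open>n\<close>. Both products are recorded, so inverting is a swap of the pair.\<close>

definition inverse_mats :: "nat \<Rightarrow> (nat \<Rightarrow> nat \<Rightarrow> complex) \<Rightarrow> (nat \<Rightarrow> nat \<Rightarrow> complex) \<Rightarrow> bool" where
  "inverse_mats n P Q \<longleftrightarrow> (\<forall>i<n. \<forall>j<n. mat_mult n P Q i j = (if i = j then 1 else 0)) \<and>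
     (\<forall>i<n. \<forall>j<n. mat_mult n Q P i j = (if i = j then 1 else 0))"

definition congruent_mats :: "nat \<Rightarrow> (nat \<Rightarrow> nat \<Rightarrow> complex) \<Rightarrow> (nat \<Rightarrow> nat \<Rightarrow> complex) \<Rightarrow> bool" where
  "congruent_mats n B C \<longleftrightarrow>
     (\<exists>P Q. inverse_mats n P Q \<and> (\<forall>i<n. \<forall>j<n. congr n P B i j = C i j))"

lemma mat_mult_assoc: "mat_mult n (mat_mult n A B) C i j = mat_mult n A (mat_mult n B C) i j"
proof -
  have "mat_mult n (mat_mult n A B) C i j = (\<Sum>a<n. \<Sum>b<n. A i b * (B b a * C a j))"
    by (simp add: mat_mult_def sum_distrib_right mult.assoc)
  also have "\<dots> = (\<Sum>b<n. \<Sum>a<n. A i b * (B b a * C a j))" by (rule sum.swap)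
  finally show ?thesis by (simp add: mat_mult_def sum_distrib_left)
qed

lemma mat_mult_id_left:
  assumes "\<And>a. a < n \<Longrightarrow> I i a = (if i = a then 1 else 0)" "i < n"
  shows "mat_mult n I A i j = A i j"
proof -
  have "mat_mult n I A i j = (\<Sum>a<n. if a = i then A i j else 0)"
    unfolding mat_mult_def by (intro sum.cong) (auto simp: assms(1))
  then show ?thesis using assms(2) by simp
qed

lemma mat_mult_inverse_mult:
  assumes "\<And>i j. i < n \<Longrightarrow> j < n \<Longrightarrow> mat_mult n P Q i j = (if i = j then 1 else 0)"
    "\<And>i j. i < n \<Longrightarrow> j < n \<Longrightarrow> mat_mult n P' Q' i j = (if i = j then 1 else 0)" "i < n" "j < n"
  shows "mat_mult n (mat_mult n P' P) (mat_mult n Q Q') i j = (if i = j then 1 else 0)"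
proof -
  have "mat_mult n P (mat_mult n Q Q') a j = Q' a j" if "a < n" for a
    using mat_mult_id_left[of n "mat_mult n P Q" a Q' j] that assms(1) by (simp add: mat_mult_assoc)
  then have "mat_mult n P' (mat_mult n P (mat_mult n Q Q')) i j = mat_mult n P' Q' i j"
    by (simp add: mat_mult_def[of n P'])
  then show ?thesis using assms by (simp add: mat_mult_assoc)
qed

lemma inverse_mats_mult:
  "inverse_mats n P Q \<Longrightarrow> inverse_mats n P' Q' \<Longrightarrow> inverse_mats n (mat_mult n P' P) (mat_mult n Q Q')"
  unfolding inverse_mats_def by (intro conjI allI impI mat_mult_inverse_mult; simp)

lemma congr_congr: "congr n P (congr n Q B) a b = congr n (mat_mult n P Q) B a b"
proof -
  have "congr n P (congr n Q B) a b =
      (\<Sum>(i, j)\<in>{..<n} \<times> {..<n}. \<Sum>(k, l)\<in>{..<n} \<times> {..<n}. P a i * Q i k * B k l * (P b j * Q j l))"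
    by (simp add: congr_def sum.cartesian_product[symmetric] sum_distrib_left sum_distrib_right mult_ac)
  also have "\<dots> = (\<Sum>(k, l)\<in>{..<n} \<times> {..<n}. \<Sum>(i, j)\<in>{..<n} \<times> {..<n}. P a i * Q i k * B k l * (P b j * Q j l))"
    unfolding case_prod_beta by (rule sum.swap)
  also have "\<dots> = (\<Sum>k<n. \<Sum>l<n. \<Sum>i<n. \<Sum>j<n. P a i * Q i k * B k l * (P b j * Q j l))"
    by (simp add: sum.cartesian_product[symmetric])
  also have "\<dots> = congr n (mat_mult n P Q) B a b"
  proof -
    have "(\<Sum>i<n. P a i * Q i k) * B k l * (\<Sum>j<n. P b j * Q j l) =
        (\<Sum>i<n. \<Sum>j<n. P a i * Q i k * B k l * (P b j * Q j l))" for k l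
      by (subst sum_distrib_right) (rule sum_product)
    then show ?thesis by (simp only: congr_def mat_mult_def)
  qed
  finally show ?thesis .
qed

lemma congr_cong: "(\<And>i j. i < n \<Longrightarrow> j < n \<Longrightarrow> B i j = C i j) \<Longrightarrow> congr n P B a b = congr n P C a b"
  by (simp add: congr_def)

lemma congr_id:
  assumes "\<And>i j. i < n \<Longrightarrow> j < n \<Longrightarrow> I i j = (if i = j then 1 else 0)" "a < n" "b < n"
  shows "congr n I B a b = B a b"
proof -
  have "congr n I B a b = (\<Sum>i<n. \<Sum>j<n. if j = b then if i = a then B a b else 0 else 0)"
    unfolding congr_def using assms by (intro sum.cong refl) auto
  then show ?thesis using assms by simp
qed

lemma congruent_mats_trans:
  assumes "congruent_mats n A B" "congruent_mats n B C"
  shows "congruent_mats n A C"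
proof -
  obtain P Q P' Q' where inv: "inverse_mats n P Q" "inverse_mats n P' Q'"
    and c: "\<And>i j. i < n \<Longrightarrow> j < n \<Longrightarrow> congr n P A i j = B i j"
      "\<And>i j. i < n \<Longrightarrow> j < n \<Longrightarrow> congr n P' B i j = C i j"
    using assms unfolding congruent_mats_def by blast
  have "congr n (mat_mult n P' P) A i j = C i j" if "i < n" "j < n" for i j
    using congr_cong[of n "congr n P A" B P' i j] c that by (simp add: congr_congr)
  then show ?thesis unfolding congruent_mats_def using inverse_mats_mult[OF inv] by blast
qed

lemma congruent_mats_sym:
  assumes "congruent_mats n A B"
  shows "congruent_mats n B A"
proof -
  obtain P Q where inv: "inverse_mats n P Q" and c: "\<And>i j. i < n \<Longrightarrow> j < n \<Longrightarrow> congr n P A i j = B i j"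
    using assms unfolding congruent_mats_def by blast
  have "congr n Q B i j = A i j" if "i < n" "j < n" for i j
    using congr_cong[of n "congr n P A" B Q i j] c that congr_id[of n "mat_mult n Q P" i j A] inv
    by (simp add: congr_congr inverse_mats_def)
  moreover have "inverse_mats n Q P" using inv by (auto simp: inverse_mats_def)
  ultimately show ?thesis unfolding congruent_mats_def by blast
qed

lemma congruent_mats_cong:
  assumes "\<And>i j. i < n \<Longrightarrow> j < n \<Longrightarrow> A i j = B i j"
  shows "congruent_mats n A B"
proof -
  let ?I = "\<lambda>i j. if i = j then 1 else (0::complex)"
  have "inverse_mats n ?I ?I"
    unfolding inverse_mats_def by (simp add: mat_mult_id_left)
  moreover have "congr n ?I A i j = B i j" if "i < n" "j < n" for i j
    using that assms by (simp add: congr_id)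
  ultimately show ?thesis unfolding congruent_mats_def by blast
qed

section \<open>Diagonalisation by congruence\<close>

text \<open>\<open>b\<^sub>i\<close> is replaced by \<open>b\<^sub>i + c i b\<^sub>m\<close> in the bilinear form.\<close>

definition transvect :: "nat \<Rightarrow> (nat \<Rightarrow> complex) \<Rightarrow> (nat \<Rightarrow> nat \<Rightarrow> complex) \<Rightarrow> nat \<Rightarrow> nat \<Rightarrow> complex" where
  "transvect m c B i j = B i j + c i * B m j + c j * (B i m + c i * B m m)"

text \<open>The change of basis is 1 + N, where N has the single nonzero column \<open>c\<close> in
  position \<open>m\<close>. The condition \<open>c m = 0\<close> makes N square to zero, so the
  inverse is 1 - N.\<close>

lemma congruent_transvect:
  assumes "m < n" "c m = 0"
  shows "congruent_mats n B (transvect m c B)"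
proof -
  let ?P = "\<lambda>c i k. (if i = k then 1 else 0) + (if k = m then c i else (0::complex))"
  have row: "(\<Sum>k<n. ?P c i k * f k) = f i + c i * f m" if "i < n" for c i and f :: "nat \<Rightarrow> complex"
  proof -
    have "(\<Sum>k<n. ?P c i k * f k) = (\<Sum>k<n. (if k = i then f i else 0) + (if k = m then c i * f m else 0))"
      by (intro sum.cong) (auto simp: distrib_right)
    also have "\<dots> = f i + c i * f m" using that assms(1) by (simp add: sum.distrib)
    finally show ?thesis .
  qed
  have "congr n (?P c) B i j = transvect m c B i j" if "i < n" "j < n" for i j
  proof -
    have "congr n (?P c) B i j = (\<Sum>k<n. ?P c i k * (\<Sum>l<n. ?P c j l * B k l))"
      unfolding congr_def sum_distrib_left by (intro sum.cong refl) (simp only: mult_ac)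
    also have "\<dots> = (\<Sum>k<n. ?P c i k * (B k j + c j * B k m))"
      by (intro sum.cong refl) (simp only: row[OF that(2)])
    also have "\<dots> = B i j + c j * B i m + c i * (B m j + c j * B m m)"
      by (rule row[OF that(1)])
    finally show ?thesis by (simp add: transvect_def algebra_simps)
  qed
  moreover have "inverse_mats n (?P c) (?P (\<lambda>i. - c i))"
  proof -
    have "mat_mult n (?P e) (?P d) i j = (if i = j then 1 else 0)"
      if "i < n" "d i = - e i" "d m = 0" for e d i j
    proof -
      have "mat_mult n (?P e) (?P d) i j = ?P d i j + e i * ?P d m j"
        unfolding mat_mult_def by (rule row[OF that(1)])
      then show ?thesis using that by simp
    qed
    then show ?thesis unfolding inverse_mats_def using assms(2) by simp
  qed
  ultimately show ?thesis unfolding congruent_mats_def by blast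
qed

text \<open>Symmetric Gaussian elimination. \<open>J\<close> is the set of indices among which
  off-diagonal entries may still occur, and each step splits off one index of it.\<close>

lemma congruent_diagonal:
  assumes "J \<subseteq> {..<n}" "\<And>i j. B i j = B j i"
    "\<And>i j. i < n \<Longrightarrow> j < n \<Longrightarrow> i \<noteq> j \<Longrightarrow> \<not> (i \<in> J \<and> j \<in> J) \<Longrightarrow> B i j = 0"
  shows "\<exists>C. congruent_mats n B C \<and> (\<forall>i<n. \<forall>j<n. i \<noteq> j \<longrightarrow> C i j = 0)"
  using assms
proof (induction "card J" arbitrary: J B)
  case 0
  then have "J = {}" using finite_subset_lessThan by (metis card_eq_0_iff)
  then show ?case using 0 congruent_mats_cong[of n B B] by auto
next
  case (Suc k)
  note J = Suc.prems(1) and sym = Suc.prems(2) and off = Suc.prems(3)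
  \<comment> \<open>Stated for every \<open>C\<close> congruent to \<open>B\<close>, so that it also
    serves after a change of basis that first has to create the pivot.\<close>
  have pivot: ?case if m: "m \<in> J" "C m m \<noteq> 0" and C: "congruent_mats n B C" "\<And>i j. C i j = C j i"
      "\<And>i j. i < n \<Longrightarrow> j < n \<Longrightarrow> i \<noteq> j \<Longrightarrow> \<not> (i \<in> J \<and> j \<in> J) \<Longrightarrow> C i j = 0" for m C
  proof -
    \<comment> \<open>The coefficients that clear the row and the column of the pivot
      \<open>m\<close>; outside \<open>J - {m}\<close> nothing is added, which preserves the zeros
      already present.\<close>
    define c where "c i = (if i \<in> J - {m} then - C i m / C m m else 0)" for i
    have mn: "m < n" using m(1) J by auto
    have C1: "congruent_mats n C (transvect m c C)"
      using mn by (intro congruent_transvect) (simp_all add: c_def)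
    have k: "k = card (J - {m})" using Suc.hyps(2) m(1) by simp
    have sym1: "transvect m c C i j = transvect m c C j i" for i j
      unfolding transvect_def C(2)[of j i] C(2)[of m i] C(2)[of m j] by (simp add: algebra_simps)
    have off1: "transvect m c C i j = 0" if ij: "i < n" "j < n" "i \<noteq> j" "j \<notin> J - {m}" for i j
    proof (cases "j = m")
      case True
      then have "c j = 0" by (simp add: c_def)
      then have "transvect m c C i j = C i m + c i * C m m" using True by (simp add: transvect_def)
      also have "\<dots> = 0"
        using m(2) ij True C(3)[of i m] mn by (cases "i \<in> J") (auto simp: c_def)
      finally show ?thesis .
    next
      case False
      then have "j \<notin> J" using ij by simp
      then have "C i j = 0" "C m j = 0" "c j = 0" using C(3) ij mn m(1) False by (auto simp: c_def)
      then show ?thesis by (simp add: transvect_def)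
    qed
    have "\<exists>E. congruent_mats n (transvect m c C) E \<and> (\<forall>i<n. \<forall>j<n. i \<noteq> j \<longrightarrow> E i j = 0)"
    proof (rule Suc.hyps(1)[OF k])
      show "J - {m} \<subseteq> {..<n}" using J by auto
      show "transvect m c C i j = transvect m c C j i" for i j by (rule sym1)
      show "transvect m c C i j = 0"
        if "i < n" "j < n" "i \<noteq> j" "\<not> (i \<in> J - {m} \<and> j \<in> J - {m})" for i j
        using that off1[of i j] off1[of j i] sym1[of i j] by auto
    qed
    then show ?thesis using congruent_mats_trans[OF congruent_mats_trans[OF C(1) C1]] by blast
  qed
  show ?case
  proof (cases "\<exists>m\<in>J. B m m \<noteq> 0")
    case True
    then show ?thesis using pivot congruent_mats_cong[of n B B] sym off by blast
  next
    case diag0: False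
    show ?thesis
    proof (cases "\<exists>i\<in>J. \<exists>j\<in>J. i \<noteq> j \<and> B i j \<noteq> 0")
      case True
      then obtain i j where ij: "i \<in> J" "j \<in> J" "i \<noteq> j" "B i j \<noteq> 0" by blast
      \<comment> \<open>All diagonal entries over \<open>J\<close> vanish, so replacing b_i by b_i +
        b_j creates the diagonal entry \<open>2 * B i j\<close>, which is nonzero.\<close>
      define c where "c k = (if k = i then 1 else 0 :: complex)" for k
      let ?C = "transvect j c B"
      have jn: "j < n" using ij J by auto
      show ?thesis
      proof (rule pivot[of i ?C])
        show "?C i i \<noteq> 0"
          using ij diag0 sym[of j i] by (simp add: transvect_def c_def)
        show "congruent_mats n B ?C" using ij jn by (intro congruent_transvect) (auto simp: c_def)
        show "?C a b = ?C b a" for a b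
          unfolding transvect_def sym[of b a] sym[of j a] sym[of j b] by (simp add: algebra_simps)
        show "?C a b = 0" if "a < n" "b < n" "a \<noteq> b" "\<not> (a \<in> J \<and> b \<in> J)" for a b
          using that ij off[of a b] off[of j b] off[of a j] jn
          by (auto simp: transvect_def c_def)
      qed (rule ij(1))
    next
      case False
      then have "\<forall>i<n. \<forall>j<n. i \<noteq> j \<longrightarrow> B i j = 0" using off by metis
      then show ?thesis using congruent_mats_cong[of n B B] by blast
    qed
  qed
qed

definition diag_mat :: "nat set \<Rightarrow> nat \<Rightarrow> nat \<Rightarrow> complex" where
  "diag_mat S i j = (if i = j \<and> i \<in> S then 1 else 0)"

text \<open>Over the complex numbers nonzero diagonal entries can be rescaled to 1. The set
  \<open>S\<close> is not canonical, only its size is an invariant, but there are finitely many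
  candidates and that suffices.\<close>

lemma congruent_diag_mat:
  assumes "\<And>i j. B i j = B j i"
  shows "\<exists>S\<in>Pow {..<n}. congruent_mats n B (diag_mat S)"
proof -
  obtain C where C: "congruent_mats n B C" "\<And>i j. i < n \<Longrightarrow> j < n \<Longrightarrow> i \<noteq> j \<Longrightarrow> C i j = 0"
    using congruent_diagonal[of "{..<n}" n B] assms by auto
  let ?S = "{i. i < n \<and> C i i \<noteq> 0}"
  \<comment> \<open>Scaling by 1 at the zero entries keeps the diagonal matrix invertible.\<close>
  define s where "s i = (if C i i = 0 then 1 else inverse (csqrt (C i i)))" for i
  let ?P = "\<lambda>s i k. if i = k then s i else (0::complex)"
  have row: "(\<Sum>k<n. ?P s i k * f k) = s i * f i" if "i < n" for s i and f :: "nat \<Rightarrow> complex"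
  proof -
    have "(\<Sum>k<n. ?P s i k * f k) = (\<Sum>k<n. if k = i then s i * f i else 0)"
      by (intro sum.cong) auto
    then show ?thesis using that by simp
  qed
  have nz: "s i \<noteq> 0" for i by (simp add: s_def)
  have sq: "s i * (s i * C i i) = 1" if "C i i \<noteq> 0" for i
  proof -
    have "csqrt (C i i) * csqrt (C i i) = C i i" by (metis power2_csqrt power2_eq_square)
    then show ?thesis using that by (simp add: s_def field_simps)
  qed
  have "congr n (?P s) C i j = diag_mat ?S i j" if "i < n" "j < n" for i j
  proof -
    have "congr n (?P s) C i j = (\<Sum>k<n. ?P s i k * (\<Sum>l<n. ?P s j l * C k l))"
      unfolding congr_def sum_distrib_left by (intro sum.cong refl) (simp only: mult_ac)
    also have "\<dots> = (\<Sum>k<n. ?P s i k * (s j * C k j))"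
      by (intro sum.cong refl) (simp only: row[OF that(2)])
    also have "\<dots> = s i * (s j * C i j)"
      by (rule row[OF that(1)])
    also have "\<dots> = diag_mat ?S i j"
      using that C(2) sq[of i] by (auto simp: diag_mat_def)
    finally show ?thesis .
  qed
  moreover have "inverse_mats n (?P s) (?P (\<lambda>i. inverse (s i)))"
  proof -
    have "mat_mult n (?P e) (?P d) i j = (if i = j then 1 else 0)"
      if "i < n" "e i * d i = 1" for e d i j
    proof -
      have "mat_mult n (?P e) (?P d) i j = e i * ?P d i j"
        unfolding mat_mult_def by (rule row[OF that(1)])
      then show ?thesis using that(2) by (cases "i = j") simp_all
    qed
    then show ?thesis unfolding inverse_mats_def by (simp add: nz)
  qed
  ultimately have "congruent_mats n C (diag_mat ?S)" unfolding congruent_mats_def by blast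
  then show ?thesis using congruent_mats_trans[OF C(1)] by blast
qed

subsection \<open>Finiteness\<close>

lemma finite_image_factor:
  assumes "finite (\<kappa> ` S)" "\<And>x y. x \<in> S \<Longrightarrow> y \<in> S \<Longrightarrow> \<kappa> x = \<kappa> y \<Longrightarrow> F x = F y"
  shows "finite (F ` S)"
proof (rule finite_subset)
  show "F ` S \<subseteq> (\<lambda>k. F (inv_into S \<kappa> k)) ` (\<kappa> ` S)"
  proof
    fix y assume "y \<in> F ` S"
    then obtain x where x: "x \<in> S" "y = F x" by blast
    then have "F (inv_into S \<kappa> (\<kappa> x)) = F x"
      by (intro assms(2)) (auto intro: inv_into_into f_inv_into_f)
    then show "y \<in> (\<lambda>k. F (inv_into S \<kappa> k)) ` (\<kappa> ` S)" using x by force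
  qed
  show "finite ((\<lambda>k. F (inv_into S \<kappa> k)) ` (\<kappa> ` S))" using assms(1) by blast
qed

context smash_product
begin

text \<open>The matrix occurs twice, so the signs cancel. This is why the defects at g and ug agree
  when u acts by -1.\<close>

lemma congr_uminus_mat:
  assumes "\<And>i j. M i j = - N i j"
  shows "congr n M B = congr n N B"
  by (simp add: fun_eq_iff congr_def assms)

lemma defect_sym:
  assumes "\<And>i j. B i j = B j i"
  shows "defect B g i j = defect B g j i"
proof -
  have "congr n M B i j = congr n M B j i" for M
    unfolding congr_def
    by (subst sum.swap) (intro sum.cong refl, subst assms, simp only: mult_ac)
  then show ?thesis by (simp add: defect_def assms[of i j])
qed

lemma dual_A_iso_of_congruent:
  assumes u: "u \<in> carrier G"
    and Du: "\<And>g i j. g \<in> carrier G \<Longrightarrow> D (inv (u \<otimes> g)) i j = - D (inv g) i j"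
    and cong: "\<And>g. g \<in> carrier G \<Longrightarrow> congruent_mats n (defect B g) (defect B' g)"
  shows "alg_iso (dual_A G n D u B') (dual_A G n D u B)"
proof -
  define good where "good X Y p \<longleftrightarrow> inverse_mats n (fst p) (snd p) \<and>
    (\<forall>i<n. \<forall>j<n. congr n (fst p) X i j = Y i j)" for X Y p
  \<comment> \<open>The choice depends on \<open>g\<close> only through the two defects. Since these
    agree at g and ug, the chosen matrices agree there automatically.\<close>
  define R where "R g = (SOME p. good (defect B g) (defect B' g) p)" for g
  have R: "good (defect B g) (defect B' g) (R g)" if "g \<in> carrier G" for g
  proof -
    have "\<exists>p. good (defect B g) (defect B' g) p"
      using cong[OF that] unfolding congruent_mats_def good_def by auto
    then show ?thesis unfolding R_def by (rule someI_ex)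
  qed
  have "defect X (u \<otimes> g) = defect X g" if "g \<in> carrier G" for g X
    using congr_uminus_mat[of "D (inv (u \<otimes> g))" "D (inv g)" X] Du[OF that] by (simp add: defect_def)
  then have Ru: "R (u \<otimes> g) = R g" if "g \<in> carrier G" for g using that by (simp add: R_def)
  show ?thesis
    by (rule dual_A_iso[OF u, of "\<lambda>g. fst (R g)" _ _ "\<lambda>g. snd (R g)"])
      (use R Ru in \<open>auto simp: good_def inverse_mats_def mat_mult_def\<close>)
qed

text \<open>The family of diagonal normal forms of the defects takes finitely many values, and
  tensors with the same family have isomorphic duals.\<close>

lemma finite_dual_A_classes:
  assumes u: "u \<in> carrier G"
    and Du: "\<And>g i j. g \<in> carrier G \<Longrightarrow> D (inv (u \<otimes> g)) i j = - D (inv g) i j"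
  shows "finite (sym_tensors n //
    {(B, B'). B \<in> sym_tensors n \<and> B' \<in> sym_tensors n \<and> alg_iso (dual_A G n D u B) (dual_A G n D u B')})"
proof -
  let ?r = "{(B, B'). B \<in> sym_tensors n \<and> B' \<in> sym_tensors n \<and> alg_iso (dual_A G n D u B) (dual_A G n D u B')}"
  \<comment> \<open>Restricting to the carrier makes the invariant extensional, so its values lie in
    a finite product \<open>Pi\<^sub>E\<close>.\<close>
  define \<kappa> where "\<kappa> B = (\<lambda>g\<in>carrier G. SOME S. S \<in> Pow {..<n} \<and> congruent_mats n (defect B g) (diag_mat S))" for B
  have \<kappa>: "\<kappa> B g \<in> Pow {..<n}" "congruent_mats n (defect B g) (diag_mat (\<kappa> B g))"
    if "B \<in> sym_tensors n" "g \<in> carrier G" for B g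
  proof -
    have "\<exists>S. S \<in> Pow {..<n} \<and> congruent_mats n (defect B g) (diag_mat S)"
      using congruent_diag_mat[of "defect B g" n] defect_sym[of B g] that(1) by (auto simp: sym_tensors_def)
    from someI_ex[OF this] show "\<kappa> B g \<in> Pow {..<n}" "congruent_mats n (defect B g) (diag_mat (\<kappa> B g))"
      using that(2) by (simp_all add: \<kappa>_def)
  qed
  have "\<kappa> ` sym_tensors n \<subseteq> Pi\<^sub>E (carrier G) (\<lambda>_. Pow {..<n})"
    using \<kappa>(1) by (intro image_subsetI PiE_I) (simp_all add: \<kappa>_def)
  then have "finite (\<kappa> ` sym_tensors n)"
    using finite_subset finite_PiE[OF finite_carrier, of "\<lambda>_. Pow {..<n}"] by simp
  then have "finite ((\<lambda>B. ?r `` {B}) ` sym_tensors n)"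
  proof (rule finite_image_factor)
    fix B B' assume B: "B \<in> sym_tensors n" "B' \<in> sym_tensors n" "\<kappa> B = \<kappa> B'"
    have "congruent_mats n (defect B g) (defect B' g)" if "g \<in> carrier G" for g
      using \<kappa>(2)[OF B(1) that] congruent_mats_sym[OF \<kappa>(2)[OF B(2) that]] B(3)
      by (auto intro: congruent_mats_trans)
    \<comment> \<open>Congruence is symmetric, which gives isomorphisms in both directions; with
      transitivity the two classes coincide.\<close>
    then have "alg_iso (dual_A G n D u B') (dual_A G n D u B)" "alg_iso (dual_A G n D u B) (dual_A G n D u B')"
      using dual_A_iso_of_congruent[OF u Du] congruent_mats_sym by blast+
    then have "alg_iso (dual_A G n D u B) (dual_A G n D u C) \<longleftrightarrow> alg_iso (dual_A G n D u B') (dual_A G n D u C)" for C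
      using alg_iso_trans by blast
    then show "?r `` {B} = ?r `` {B'}" using B by auto
  qed
  moreover have "sym_tensors n // ?r = (\<lambda>B. ?r `` {B}) ` sym_tensors n"
    by (auto simp: quotient_def)
  ultimately show ?thesis by simp
qed

end

theorem corollary5p4:
  fixes G :: "('g, 'm) monoid_scheme"
    and scale :: "complex \<Rightarrow> 'v::ab_group_add \<Rightarrow> 'v"
    and bs :: "'v list"
    and \<rho> :: "'g \<Rightarrow> 'v \<Rightarrow> 'v"
    and u :: 'g
  assumes "group G" and "finite (carrier G)"
    and "finite_dimensional_vector_space scale (set bs)" and "distinct bs"
    and "group_action G UNIV \<rho>"
    and "\<And>g. g \<in> carrier G \<Longrightarrow> Vector_Spaces.linear scale scale (\<rho> g)"
    and "u \<in> carrier G" and "\<And>g. g \<in> carrier G \<Longrightarrow> u \<otimes>\<^bsub>G\<^esub> g = g \<otimes>\<^bsub>G\<^esub> u"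
    and "group.ord G u = 2"
    and "\<And>v. \<rho> u v = - v"
  defines "n \<equiv> length bs"
    and "D \<equiv> (\<lambda>g. rep_matrix scale bs (\<rho> g))"
  shows "finite (sym_tensors n //
    {(B, B'). B \<in> sym_tensors n \<and> B' \<in> sym_tensors n \<and>
              alg_iso (dual_A G n D u B) (dual_A G n D u B')})"
proof -
  interpret group G by fact
  interpret V: finite_dimensional_vector_space scale "set bs" by fact
  interpret act: group_action G UNIV \<rho> by fact
  have span: "v \<in> V.span (set bs)" for v using V.span_Basis by simp
  have act_mult: "\<rho> (g \<otimes>\<^bsub>G\<^esub> h) v = \<rho> g (\<rho> h v)" if "g \<in> carrier G" "h \<in> carrier G" for g h v
    using act.composition_rule[of v g h] that by simp
  have act_one: "\<rho> \<one>\<^bsub>G\<^esub> v = v" for v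
    using act.id_eq_one by (metis UNIV_I restrict_apply')
  \<comment> \<open>Multiplying the inverse of ug by the central element u gives the inverse of g,
    and u acts by -1.\<close>
  have act_u: "\<rho> (inv\<^bsub>G\<^esub> (u \<otimes>\<^bsub>G\<^esub> g)) v = - \<rho> (inv\<^bsub>G\<^esub> g) v" if "g \<in> carrier G" for g v
  proof -
    have "\<rho> (u \<otimes>\<^bsub>G\<^esub> inv\<^bsub>G\<^esub> (u \<otimes>\<^bsub>G\<^esub> g)) v = - \<rho> (inv\<^bsub>G\<^esub> (u \<otimes>\<^bsub>G\<^esub> g)) v"
      using that assms(7,10) by (simp add: act_mult)
    moreover have "u \<otimes>\<^bsub>G\<^esub> inv\<^bsub>G\<^esub> (u \<otimes>\<^bsub>G\<^esub> g) = inv\<^bsub>G\<^esub> g"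
      using that assms(7,8) by (metis inv_closed inv_mult_group m_assoc m_closed r_inv r_one)
    ultimately show ?thesis by (metis minus_minus)
  qed
  have "smash_product G n D"
  proof unfold_locales
    show "finite (carrier G)" by fact
    show "D \<one>\<^bsub>G\<^esub> i j = (if i = j then 1 else 0)" if "i < n" "j < n" for i j
      using that assms(4) V.representation_basis[OF V.independent_Basis, of "bs ! j"]
      by (simp add: D_def n_def rep_matrix_def act_one nth_eq_iff_index_eq)
  qed
  then interpret smash_product G n D .
  have "D (inv\<^bsub>G\<^esub> (u \<otimes>\<^bsub>G\<^esub> g)) i j = - D (inv\<^bsub>G\<^esub> g) i j" if "g \<in> carrier G" for g i j
    using that by (simp add: D_def rep_matrix_def act_u V.representation_neg[OF V.independent_Basis span])
  then show ?thesis by (rule finite_dual_A_classes[OF assms(7)])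
qed

end
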